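(* Let $p$ be an odd prime, let $n\geq 1$ be an integer, and let $q_1,\dots,q_n$ be integers relatively prime to $p$. Then the group $G=SO(3)$ cannot act freely on the lens space $L^{2n-1}(p;q_1,\dots,q_n)$.
   Context: $SO(3)$ is the group of rotations about the origin of $\mathbb{R}^3$. Actions are continuous; an action is free if all isotropy subgroups $G_x=\{g\in G: gx=x\}$ are trivial. The lens space $L^{2n-1}(p;q_1,\dots,q_n)$ (abbreviated $L^{2n-1}(p,q)$) is the orbit space of the free $\mathbb{Z}_p$-action on the unit sphere $\mathbb{S}^{2n-1}\subset\mathbb{C}^n$ generated by $(z_1,\dots,z_n)\mapsto(\epsilon^{q_1}z_1,\dots,\epsilon^{q_n}z_n)$, where $\epsilon=e^{2\pi i/p}$ and $\mathbb{Z}_p=\mathbb{Z}/p\mathbb{Z}$. *)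

theory Defs
  imports
    "HOL-Analysis.Analysis"
    "HOL-Algebra.Group_Action"
    "HOL-Algebra.Elementary_Groups"
    "HOL-Computational_Algebra.Primes"
begin

definition quotient_topology :: "'a topology \<Rightarrow> ('a \<Rightarrow> 'b) \<Rightarrow> 'b topology" where
  "quotient_topology X f =
     topology (\<lambda>U. U \<subseteq> f ` topspace X \<and> openin X {x \<in> topspace X. f x \<in> U})"

lemma openin_quotient_topology:
  "openin (quotient_topology X f) U \<longleftrightarrow>
     U \<subseteq> f ` topspace X \<and> openin X {x \<in> topspace X. f x \<in> U}"
proof -
  let ?L = "\<lambda>U. U \<subseteq> f ` topspace X \<and> openin X {x \<in> topspace X. f x \<in> U}"
  have "istopology ?L"
    unfolding istopology_def
  proof (intro conjI allI impI)
    fix S T assume S: "?L S" and T: "?L T"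
    then show "S \<inter> T \<subseteq> f ` topspace X" by blast
    have "{x \<in> topspace X. f x \<in> S \<inter> T} =
            {x \<in> topspace X. f x \<in> S} \<inter> {x \<in> topspace X. f x \<in> T}" by blast
    with S T show "openin X {x \<in> topspace X. f x \<in> S \<inter> T}" by auto
  next
    fix K assume K: "\<forall>S\<in>K. ?L S"
    then show "\<Union>K \<subseteq> f ` topspace X" by blast
    have "{x \<in> topspace X. f x \<in> \<Union>K} = (\<Union>S\<in>K. {x \<in> topspace X. f x \<in> S})" by blast
    with K show "openin X {x \<in> topspace X. f x \<in> \<Union>K}" by auto
  qed
  then show ?thesis
    by (simp add: quotient_topology_def)
qed

lemma topspace_quotient_topology [simp]:
  "topspace (quotient_topology X f) = f ` topspace X"
proof
  show "topspace (quotient_topology X f) \<subseteq> f ` topspace X"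
    by (metis openin_quotient_topology openin_topspace)
  have "{x \<in> topspace X. f x \<in> f ` topspace X} = topspace X" by blast
  then have "openin (quotient_topology X f) (f ` topspace X)"
    by (simp add: openin_quotient_topology)
  then show "f ` topspace X \<subseteq> topspace (quotient_topology X f)"
    by (rule openin_subset)
qed

lemma quotient_map_quotient_topology: "quotient_map X (quotient_topology X f) f"
  unfolding quotient_map_def by (simp add: openin_quotient_topology)

definition SO3 :: "(real^3^3) monoid" where
  "SO3 = \<lparr>carrier = {A. rotation_matrix A}, monoid.mult = (**), one = mat 1\<rparr>"

definition SO3_topology :: "(real^3^3) topology" where
  "SO3_topology = top_of_set (carrier SO3)"

lemma group_SO3: "group SO3"
proof (rule groupI)
  fix A assume A: "A \<in> carrier SO3"
  then have "transpose A \<in> carrier SO3" "transpose A ** A = mat 1"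
    by (auto simp: SO3_def rotation_matrix_def orthogonal_matrix_def)
  then show "\<exists>B\<in>carrier SO3. B \<otimes>\<^bsub>SO3\<^esub> A = \<one>\<^bsub>SO3\<^esub>"
    by (auto simp: SO3_def)
qed (auto simp: SO3_def rotation_matrix_def orthogonal_matrix_mul orthogonal_matrix_id
      det_mul matrix_mul_assoc)

lemma topspace_SO3_topology [simp]: "topspace SO3_topology = carrier SO3"
  by (simp add: SO3_topology_def)

text \<open>
  As in \<^locale>\<open>group_action\<close>, the map \<open>\<phi> g\<close> is extensional on the space acted upon, and
  continuity is joint: \<open>(g, x) \<mapsto> \<phi> g x\<close> is continuous on the product.
\<close>

definition continuous_action ::
    "('g, 'b) monoid_scheme \<Rightarrow> 'g topology \<Rightarrow> 'a topology \<Rightarrow> ('g \<Rightarrow> 'a \<Rightarrow> 'a) \<Rightarrow> bool" where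
  "continuous_action G T X \<phi> \<longleftrightarrow>
     group_action G (topspace X) \<phi> \<and>
     continuous_map (prod_topology T X) X (\<lambda>(g, x). \<phi> g x)"

definition free_action ::
    "('g, 'b) monoid_scheme \<Rightarrow> 'a set \<Rightarrow> ('g \<Rightarrow> 'a \<Rightarrow> 'a) \<Rightarrow> bool" where
  "free_action G E \<phi> \<longleftrightarrow> (\<forall>x\<in>E. stabilizer G \<phi> x = {\<one>\<^bsub>G\<^esub>})"

text \<open>
  The coordinates of \<open>\<complex>\<^sup>n\<close> are indexed by the finite type \<open>'n\<close>, so \<open>n\<close> is \<open>CARD('n)\<close>, which is
  at least 1.
\<close>

definition lens_rotation :: "nat \<Rightarrow> ('n \<Rightarrow> int) \<Rightarrow> complex^'n \<Rightarrow> complex^'n" where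
  "lens_rotation p q z = (\<chi> i. exp (2 * of_real pi * \<i> / of_nat p) powi q i * z $ i)"

definition lens_action :: "nat \<Rightarrow> ('n \<Rightarrow> int) \<Rightarrow> int \<Rightarrow> complex^'n \<Rightarrow> complex^'n" where
  "lens_action p q k = restrict (lens_rotation p q ^^ nat k) (sphere 0 1)"

definition lens_space :: "nat \<Rightarrow> ('n \<Rightarrow> int) \<Rightarrow> (complex^'n) set topology" where
  "lens_space p q =
     quotient_topology (top_of_set (sphere 0 1)) (orbit (integer_mod_group p) (lens_action p q))"

lemma topspace_lens_space:
  "topspace (lens_space p q) = orbits (integer_mod_group p) (sphere 0 1) (lens_action p q)"
  by (auto simp: lens_space_def orbits_def)

lemma lens_root_powi_eq_1_iff:
  assumes "p > 0"
  shows "exp (2 * of_real pi * \<i> / of_nat p) powi m = 1 \<longleftrightarrow> int p dvd m"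
proof -
  have "exp (2 * of_real pi * \<i> / of_nat p) powi m =
          exp (of_int m * (2 * of_real pi * \<i> / of_nat p))"
    by (simp add: exp_power_int)
  also have "\<dots> = 1 \<longleftrightarrow> (\<exists>n::int. 2 * pi * m / p = 2 * pi * n)"
    unfolding exp_eq_1 by (simp add: mult_ac)
  also have "\<dots> \<longleftrightarrow> (\<exists>n::int. real_of_int m = real_of_int (int p * n))"
    using assms by (simp add: field_simps)
  also have "\<dots> \<longleftrightarrow> int p dvd m"
    by (auto simp only: of_int_eq_iff dvd_def)
  finally show ?thesis .
qed

lemma lens_rotation_funpow:
  "(lens_rotation p q ^^ k) z =
     (\<chi> i. exp (2 * of_real pi * \<i> / of_nat p) powi (q i * int k) * z $ i)"
proof (induction k)
  case 0
  then show ?case by simp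
next
  case (Suc k)
  then show ?case
    by (simp add: lens_rotation_def vec_eq_iff distrib_left power_int_add)
qed

lemma norm_lens_rotation_funpow: "norm ((lens_rotation p q ^^ k) z) = norm z"
  by (simp add: lens_rotation_funpow norm_vec_def norm_mult norm_power_int)

lemma lens_rotation_funpow_mod:
  assumes "p > 0"
  shows "lens_rotation p q ^^ (k mod p) = lens_rotation p q ^^ k"
proof -
  have "lens_rotation p q ^^ p = id"
    using assms by (simp add: fun_eq_iff vec_eq_iff lens_rotation_funpow lens_root_powi_eq_1_iff)
  then show ?thesis
    by (intro ext funpow_mod_eq) simp
qed

lemma group_action_lens:
  fixes q :: "'n::finite \<Rightarrow> int"
  assumes "p > 0"
  shows "group_action (integer_mod_group p) (sphere 0 1) (lens_action p q)"
proof -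
  let ?S = "sphere (0 :: complex^'n) 1"
  let ?r = "lens_rotation p q"
  have add: "lens_action p q ((k + l) mod int p) = compose ?S (lens_action p q k) (lens_action p q l)"
    if "k \<ge> 0" "l \<ge> 0" for k l
  proof -
    have "nat ((k + l) mod int p) = (nat k + nat l) mod p"
      using that by (simp add: nat_mod_distrib nat_add_distrib)
    then show ?thesis
      using assms by (simp add: fun_eq_iff lens_action_def compose_def
          lens_rotation_funpow_mod funpow_add norm_lens_rotation_funpow)
  qed
  have zero: "lens_action p q 0 = restrict id ?S"
    by (simp add: lens_action_def id_def)
  have maps: "lens_action p q k \<in> ?S \<rightarrow> ?S" for k
    by (auto simp: lens_action_def norm_lens_rotation_funpow)
  have bij: "lens_action p q k \<in> Bij ?S" if k: "k \<in> {0..<int p}" for k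
  proof -
    let ?l = "(- k) mod int p"
    have l: "?l \<ge> 0" using assms by simp
    have inv: "lens_action p q ?l (lens_action p q k z) = z"
        "lens_action p q k (lens_action p q ?l z) = z" if z: "z \<in> ?S" for z
      using fun_cong[OF add[OF l, of k], of z] fun_cong[OF add[OF _ l, of k], of z] k z
      by (simp_all add: zero mod_simps compose_eq)
    have "bij_betw (lens_action p q k) ?S ?S"
      by (rule bij_betwI[where g = "lens_action p q ?l"]) (simp_all only: maps inv)
    then show ?thesis
      by (simp add: Bij_def lens_action_def)
  qed
  have "lens_action p q \<in> hom (integer_mod_group p) (BijGroup ?S)"
  proof (rule homI)
    fix k l assume k: "k \<in> carrier (integer_mod_group p)" and l: "l \<in> carrier (integer_mod_group p)"
    then have "k \<in> {0..<int p}" "l \<in> {0..<int p}"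
      using assms by (simp_all add: carrier_integer_mod_group)
    then show "lens_action p q (k \<otimes>\<^bsub>integer_mod_group p\<^esub> l) =
        lens_action p q k \<otimes>\<^bsub>BijGroup ?S\<^esub> lens_action p q l"
      by (simp add: BijGroup_def bij add)
  next
    fix k assume "k \<in> carrier (integer_mod_group p)"
    then show "lens_action p q k \<in> carrier (BijGroup ?S)"
      using assms bij by (simp add: carrier_integer_mod_group BijGroup_def)
  qed
  then show ?thesis
    by (intro group_action.intro group_hom.intro group_hom_axioms.intro group_BijGroup)
      simp_all
qed

lemma free_action_lens:
  fixes q :: "'n::finite \<Rightarrow> int"
  assumes "p > 0" and "\<And>i. coprime (q i) (int p)"
  shows "free_action (integer_mod_group p) (sphere 0 1) (lens_action p q)"
proof -
  have zero: "k = 0" if k: "0 \<le> k" "k < int p" and z: "norm z = 1" and eq: "lens_action p q k z = z"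
    for k and z :: "complex^'n"
  proof -
    obtain i where i: "z $ i \<noteq> 0"
      using z by (metis norm_zero vec_eq_iff zero_index zero_neq_one)
    have "(lens_rotation p q ^^ nat k) z $ i = z $ i"
      using eq z by (simp add: lens_action_def)
    then have "exp (2 * of_real pi * \<i> / of_nat p) powi (q i * k) = 1"
      using i k by (simp add: lens_rotation_funpow)
    then have "int p dvd q i * k"
      using assms(1) lens_root_powi_eq_1_iff by blast
    then have "int p dvd k"
      using assms(2)[of i] by (simp add: coprime_commute coprime_dvd_mult_right_iff)
    then show "k = 0"
      using k zdvd_imp_le by fastforce
  qed
  have "stabilizer (integer_mod_group p) (lens_action p q) z = {0}" if "norm z = 1"
    for z :: "complex^'n"
    unfolding stabilizer_def carrier_integer_mod_group
    using assms(1) that by (auto intro: zero) (simp add: lens_action_def)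
  then show ?thesis
    by (simp add: free_action_def)
qed

end

theory Submission
  imports Defs "HOL-Homology.Homology"
begin

text \<open>
  Write \<open>S\<close> for the unit sphere of \<open>\<complex>\<^sup>n\<close>. The proof turns a free action of \<open>SO(3)\<close> on the lens
  space into a free action of the Klein four-group on \<open>S\<close>, and then excludes the latter by a parity
  count of mapping degrees.

  Lifting. A rotation close to the identity moves the points of the lens space only a little, so
  over each point of \<open>S\<close> it has exactly one lift that is closer to that point than half the
  distance between points of one fibre. Uniqueness makes these lifts continuous in the point and
  makes them commute with the deck transformations (\<open>small_rotations_lift\<close>). Every rotation about a
  coordinate axis is a power of a small one, hence lifts in the same way. Take the half turns \<open>a\<close>
  and \<open>b\<close> about two coordinate axes, with lifts \<open>A\<close> and \<open>B\<close>. By connectedness of \<open>S\<close>, two maps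
  with equal projections differ by a single deck transformation (\<open>equal_proj_imp_deck\<close>). Hence
  \<open>A\<^sup>2\<close> is a deck transformation, and because \<open>p\<close> is odd, \<open>A\<close> can be multiplied by a deck
  transformation so as to become an involution; likewise \<open>B\<close>. The commutator of \<open>A\<close> and \<open>B\<close> is a
  deck transformation equal to its own inverse, hence trivial, again because \<open>p\<close> is odd. So \<open>A\<close>
  and \<open>B\<close> generate a Klein four-group acting on \<open>S\<close>, freely because \<open>a\<close>, \<open>b\<close> and \<open>ab\<close> act freely below.

  Excluding the four-group. Maps of \<open>S\<close> that are equivariant for given actions of a finite group
  exist as soon as the action on the source is free, since \<open>S\<close> as a source has the same dimension
  as the target sphere and there is no obstruction to extending maps orbit by orbit
  (\<open>extend_equivariantly\<close>). This yields

  \<^item> a map \<open>f\<close> with \<open>f \<circ> A = f\<close> and \<open>f \<circ> B = -f\<close>, and a map \<open>f'\<close> with \<open>f' \<circ> A = -f'\<close>,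
  \<^item> maps \<open>h\<^sub>A\<close> and \<open>h\<^sub>B\<close> carrying the antipodal involution to \<open>A\<close> and to \<open>B\<close>, respectively.

  Now \<open>f \<circ> h\<^sub>B\<close> and \<open>f' \<circ> h\<^sub>A\<close> are odd maps and so have odd degree, while \<open>f \<circ> h\<^sub>A\<close> is an even map
  and has even degree (\<open>sign_symmetric_degree_parity\<close>, a form of Borsuk's theorem). The first fact
  makes the degree of \<open>f\<close> odd, so the third makes the degree of \<open>h\<^sub>A\<close> even, against the second.

  The parity theorem says that the degrees of two odd maps, or of two even maps, are congruent
  modulo 2. One of the maps is deformed, within its symmetry class, until it agrees with the other
  on the equator. Exchanging the two maps on one hemisphere then gives two new maps with the same
  total degree (\<open>sphere_degree_glue\<close>), and the antipodal map conjugates these new maps into each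
  other up to sign. In odd dimensions the antipodal map has degree 1, so the total degree is even.
\<close>

section \<open>The mapping degree on a Euclidean unit sphere\<close>

text \<open>
  Excision identifies the homology of the sphere relative to its lower half with that of the upper
  half relative to the equator. A cycle is therefore homologous, modulo the lower half, to a chain
  in the upper half, and the remainder is a chain in the lower half.
\<close>

lemma nsphere_cycle_split:
  assumes "c \<in> carrier (homology_group (int p) (nsphere n))"
  obtains c1 c2 where
    "singular_chain p (subtopology (nsphere n) {x. x k \<ge> 0}) c1"
    "singular_chain p (subtopology (nsphere n) {x. x k \<le> 0}) c2"
    "singular_relcycle p (nsphere n) {} (c1 + c2)"
    "c = homologous_rel_set p (nsphere n) {} (c1 + c2)"
proof -
  let ?X = "nsphere n"
  let ?D = "subtopology ?X {x. x k \<ge> 0}" and ?E = "{x::nat\<Rightarrow>real. x k = 0}" and ?L = "{x::nat\<Rightarrow>real. x k \<le> 0}"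
  obtain z where z: "singular_relcycle p ?X {} z" and c: "c = homologous_rel_set p ?X {} z"
    using assms by (auto simp: carrier_relative_homology_group)
  have zL: "singular_relcycle p ?X ?L z"
    using z by (auto simp: singular_relcycle singular_chain_empty)
  have "homologous_rel_set p ?X ?L z \<in> carrier (relative_homology_group (int p) ?X ?L)"
    using zL by (auto simp: carrier_relative_homology_group)
  then obtain w where w: "singular_relcycle p ?D ?E w"
      and weq: "homologous_rel_set p ?X ?L z = hom_induced (int p) ?D ?E ?X ?L id (homologous_rel_set p ?D ?E w)"
    using iso_relative_homology_group_upper_hemisphere [of "int p" n k]
    unfolding iso_def bij_betw_def carrier_relative_homology_group by blast
  have wD: "singular_chain p ?D w"
    using w by (simp add: singular_relcycle_def)
  then have wX: "singular_chain p ?X w"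
    by (simp add: singular_chain_subtopology)
  have "hom_induced (int p) ?D ?E ?X ?L id (homologous_rel_set p ?D ?E w)
      = homologous_rel_set p ?X ?L (chain_map p id w)"
    by (rule hom_induced_chain_map) (use w in auto)
  then have "homologous_rel_set p ?X ?L z = homologous_rel_set p ?X ?L w"
    using weq wX by (simp add: chain_map_id_gen)
  then have "singular_relboundary p ?X ?L (z - w)"
    by (metis homologous_rel_def homologous_rel_set_eq)
  then obtain d e where e: "singular_chain (Suc p) ?X e" and d: "singular_chain p (subtopology ?X ?L) d"
      and ed: "chain_boundary (Suc p) e = (z - w) + d"
    by (auto simp: singular_relboundary_alt)
  have "singular_relboundary p ?X {} (z - (w + - d))"
    using e ed by (auto simp: singular_boundary algebra_simps)
  then have "homologous_rel p ?X {} z (w + - d)"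
    by (simp add: homologous_rel_def)
  then have eq: "homologous_rel_set p ?X {} z = homologous_rel_set p ?X {} (w + - d)"
    by (simp add: homologous_rel_set_eq)
  have "singular_relcycle p ?X {} (w + - d)"
    using \<open>homologous_rel p ?X {} z (w + - d)\<close> z homologous_rel_singular_relcycle by blast
  with eq c wD d show thesis
    by (intro that [of w "- d"]) (auto simp: singular_chain_minus)
qed

text \<open>
  The index \<open>i\<close> selects the map used on the upper half and \<open>j\<close> the one used on the lower half. For a
  fundamental cycle split as \<open>c1 + c2\<close> along the equator, the images of \<open>c1\<close> depend on \<open>i\<close> only and
  those of \<open>c2\<close> on \<open>j\<close> only, so both sides of the equation describe the same sum of cycles.
\<close>

lemma Brouwer_degree2_glue:
  fixes f :: "bool \<Rightarrow> bool \<Rightarrow> (nat \<Rightarrow> real) \<Rightarrow> nat \<Rightarrow> real"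
  assumes cont: "\<And>i j. continuous_map (nsphere n) (nsphere n) (f i j)"
    and upper: "\<And>i x. x \<in> topspace (nsphere n) \<Longrightarrow> x k \<ge> 0 \<Longrightarrow> f i True x = f i False x"
    and lower: "\<And>j x. x \<in> topspace (nsphere n) \<Longrightarrow> x k \<le> 0 \<Longrightarrow> f True j x = f False j x"
  shows "Brouwer_degree2 n (f False False) + Brouwer_degree2 n (f True True)
       = Brouwer_degree2 n (f False True) + Brouwer_degree2 n (f True False)"
proof -
  let ?X = "nsphere n"
  let ?H = "homology_group (int n) ?X" and ?G = "reduced_homology_group (int n) ?X"
  interpret G: group ?G by simp
  interpret H: comm_group ?H by (rule abelian_homology_group)
  obtain a where a: "a \<in> carrier ?G" and aeq: "subgroup_generated ?G {a} = ?G"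
    using cyclic_reduced_homology_group_nsphere [of n n] by (auto simp: cyclic_group_def)
  have ord: "G.ord a = 0"
    by (simp add: a aeq iso_finite [OF reduced_homology_group_nsphere(1)] flip: G.infinite_cyclic_subgroup_order)
  have aH: "a \<in> carrier ?H"
    using a carrier_reduced_homology_group_subset by blast
  obtain c1 c2 where c1: "singular_chain n (subtopology ?X {x. x k \<ge> 0}) c1"
    and c2: "singular_chain n (subtopology ?X {x. x k \<le> 0}) c2"
    and cyc: "singular_relcycle n ?X {} (c1 + c2)"
    and ac: "a = homologous_rel_set n ?X {} (c1 + c2)"
    using nsphere_cycle_split [OF aH] by metis
  let ?m = "\<lambda>i j. chain_map n (f i j) (c1 + c2)"
  have ind: "a [^]\<^bsub>?G\<^esub> Brouwer_degree2 n (f i j) = homologous_rel_set n ?X {} (?m i j)" for i j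
    using Brouwer_degree2 [OF a, of "f i j"] hom_induced_chain_map [OF cont [of i j] _ cyc, of "{}"]
    by (simp add: ac)
  have cycm: "singular_relcycle n ?X {} (?m i j)" for i j
    using singular_relcycle_chain_map [OF cyc cont [of i j], of "{}"] by simp
  have mult: "homologous_rel_set n ?X {} x \<otimes>\<^bsub>?G\<^esub> homologous_rel_set n ?X {} y
       = homologous_rel_set n ?X {} (x + y)"
    if "singular_relcycle n ?X {} x" "singular_relcycle n ?X {} y" for x y
  proof -
    have "homologous_rel_set n ?X {} x \<otimes>\<^bsub>?H\<^esub> homologous_rel_set n ?X {} y
       = homologous_rel_set n ?X {} (x + y)"
      unfolding mult_relative_homology_group
      apply auto
       apply (meson homologous_rel_add)
      by (metis add_diff_cancel_left' add_diff_cancel_right' diff_add_cancel homologous_rel_diff homologous_rel_refl homologous_rel_sym)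
    then show ?thesis by (simp add: reduced_homology_group_def)
  qed
  have eq1: "chain_map n (f i True) c1 = chain_map n (f i False) c1" for i
    by (rule chain_map_eq [OF c1]) (simp add: upper)
  have eq2: "chain_map n (f True j) c2 = chain_map n (f False j) c2" for j
    by (rule chain_map_eq [OF c2]) (simp add: lower)
  have "?m False False + ?m True True = ?m False True + ?m True False"
    by (simp add: chain_map_add eq1 eq2)
  then have "a [^]\<^bsub>?G\<^esub> Brouwer_degree2 n (f False False) \<otimes>\<^bsub>?G\<^esub> a [^]\<^bsub>?G\<^esub> Brouwer_degree2 n (f True True)
    = a [^]\<^bsub>?G\<^esub> Brouwer_degree2 n (f False True) \<otimes>\<^bsub>?G\<^esub> a [^]\<^bsub>?G\<^esub> Brouwer_degree2 n (f True False)"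
    by (simp add: ind mult cycm)
  then show ?thesis
    using a ord by (simp add: G.int_pow_eq flip: G.int_pow_mult)
qed

text \<open>
  \<^const>\<open>Brouwer_degree2\<close> concerns a sphere of real sequences. A linear isometry, given by
  an enumeration of the standard basis, carries it to the unit sphere of a Euclidean space. The pole
  corresponds to the coordinate with index 0, so hemispheres go to hemispheres.
\<close>

definition basis_enum :: "nat \<Rightarrow> 'a::euclidean_space" where
  "basis_enum = (SOME b. bij_betw b {..<DIM('a)} Basis)"

definition pole :: "'a::euclidean_space" where
  "pole = basis_enum 0"

definition to_nsphere :: "'a::euclidean_space \<Rightarrow> nat \<Rightarrow> real" where
  "to_nsphere x = (\<lambda>i. if i < DIM('a) then x \<bullet> basis_enum i else 0)"

definition from_nsphere :: "(nat \<Rightarrow> real) \<Rightarrow> 'a::euclidean_space" where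
  "from_nsphere y = (\<Sum>i<DIM('a). y i *\<^sub>R basis_enum i)"

lemma to_nsphere_0: "to_nsphere x 0 = x \<bullet> pole"
  by (simp add: to_nsphere_def pole_def)

lemma bij_basis_enum: "bij_betw (basis_enum :: nat \<Rightarrow> 'a::euclidean_space) {..<DIM('a)} Basis"
proof -
  have "\<exists>b. bij_betw b {..<DIM('a)} (Basis :: 'a set)"
    using ex_bij_betw_nat_finite [of "Basis :: 'a set"] by (simp add: atLeast0LessThan)
  then show ?thesis
    unfolding basis_enum_def by (rule someI_ex)
qed

lemma basis_enum_in_Basis: "i < DIM('a) \<Longrightarrow> (basis_enum i :: 'a::euclidean_space) \<in> Basis"
  by (rule bij_betw_apply [OF bij_basis_enum]) simp

lemma pole_in_Basis [simp]: "pole \<in> Basis"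
  unfolding pole_def by (rule basis_enum_in_Basis) simp

lemma inner_basis_enum:
  assumes "i < DIM('a)" "j < DIM('a)"
  shows "(basis_enum i :: 'a::euclidean_space) \<bullet> basis_enum j = (if i = j then 1 else 0)"
proof -
  have "(basis_enum i :: 'a) = basis_enum j \<longleftrightarrow> i = j"
    using assms by (intro inj_on_eq_iff [OF bij_betw_imp_inj_on [OF bij_basis_enum]]) auto
  then show ?thesis using assms by (simp add: inner_Basis basis_enum_in_Basis)
qed

lemma from_to_nsphere [simp]: "from_nsphere (to_nsphere x) = (x :: 'a::euclidean_space)"
proof -
  have "(from_nsphere (to_nsphere x) :: 'a) = (\<Sum>i<DIM('a). (x \<bullet> basis_enum i) *\<^sub>R basis_enum i)"
    by (simp add: from_nsphere_def to_nsphere_def)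
  also have "\<dots> = (\<Sum>b\<in>Basis. (x \<bullet> b) *\<^sub>R b)"
    by (rule sum.reindex_bij_betw [OF bij_basis_enum])
  finally show ?thesis by (simp add: euclidean_representation)
qed

lemma to_from_nsphere:
  assumes "\<And>i. i \<ge> DIM('a) \<Longrightarrow> y i = 0"
  shows "to_nsphere (from_nsphere y :: 'a::euclidean_space) = y"
proof
  fix i
  show "to_nsphere (from_nsphere y :: 'a) i = y i"
  proof (cases "i < DIM('a)")
    case True
    then have "(from_nsphere y :: 'a) \<bullet> basis_enum i = (\<Sum>j<DIM('a). y j * (if j = i then 1 else 0))"
      by (simp add: from_nsphere_def inner_sum_left inner_basis_enum)
    also have "\<dots> = y i"
      using True by (simp add: if_distrib [where f = "\<lambda>c. _ * c"] cong: if_cong)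
    finally show ?thesis using True by (simp add: to_nsphere_def)
  qed (use assms in \<open>simp add: to_nsphere_def\<close>)
qed

lemma norm_to_nsphere: "(\<Sum>i<DIM('a). (to_nsphere x i)\<^sup>2) = (norm (x :: 'a::euclidean_space))\<^sup>2"
proof -
  have "(\<Sum>i<DIM('a). (to_nsphere x i)\<^sup>2) = (\<Sum>i<DIM('a). (x \<bullet> basis_enum i)\<^sup>2)"
    by (simp add: to_nsphere_def)
  also have "\<dots> = (\<Sum>b\<in>Basis. (x \<bullet> b)\<^sup>2)"
    by (rule sum.reindex_bij_betw [OF bij_basis_enum])
  also have "\<dots> = x \<bullet> x"
    by (simp only: euclidean_inner [of x x] power2_eq_square)
  finally show ?thesis
    by (simp add: power2_norm_eq_inner)
qed

lemma topspace_nsphere_DIM: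
  "topspace (nsphere (DIM('a::euclidean_space) - Suc 0)) = to_nsphere ` (sphere (0::'a) 1)"
proof -
  have mem: "y \<in> topspace (nsphere (DIM('a) - Suc 0)) \<longleftrightarrow>
      (\<Sum>i<DIM('a). (y i)\<^sup>2) = 1 \<and> (\<forall>i\<ge>DIM('a). y i = 0)" for y
  proof -
    obtain m where m: "DIM('a) = Suc m"
      using DIM_positive[where 'a='a] gr0_implies_Suc by blast
    show ?thesis
      unfolding nsphere m by (simp add: lessThan_Suc_atMost Suc_le_eq)
  qed
  show ?thesis
  proof (intro equalityI subsetI)
    fix y assume "y \<in> topspace (nsphere (DIM('a) - Suc 0))"
    then have y: "(\<Sum>i<DIM('a). (y i)\<^sup>2) = 1" "\<And>i. i \<ge> DIM('a) \<Longrightarrow> y i = 0"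
      unfolding mem by blast+
    then have "to_nsphere (from_nsphere y :: 'a) = y"
      by (intro to_from_nsphere)
    moreover from this have "norm (from_nsphere y :: 'a) = 1"
      using norm_to_nsphere[of "from_nsphere y :: 'a"] y norm_ge_zero[of "from_nsphere y :: 'a"]
      by (auto simp: power2_eq_1_iff)
    ultimately show "y \<in> to_nsphere ` (sphere (0::'a) 1)"
      by (metis dist_0_norm imageI mem_sphere)
  next
    fix y assume "y \<in> to_nsphere ` (sphere (0::'a) 1)"
    then show "y \<in> topspace (nsphere (DIM('a) - Suc 0))"
      unfolding mem by (auto simp: norm_to_nsphere) (simp add: to_nsphere_def)
  qed
qed

lemma homeomorphic_maps_nsphere_sphere:
  "homeomorphic_maps (nsphere (DIM('a) - Suc 0)) (top_of_set (sphere (0::'a::euclidean_space) 1))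
     from_nsphere to_nsphere"
  unfolding homeomorphic_maps_def
proof (intro conjI ballI)
  show "continuous_map (nsphere (DIM('a) - Suc 0)) (top_of_set (sphere (0::'a) 1)) from_nsphere"
    unfolding continuous_map_in_subtopology
  proof
    show "continuous_map (nsphere (DIM('a) - Suc 0)) euclidean (from_nsphere :: _ \<Rightarrow> 'a)"
      unfolding from_nsphere_def
    proof (rule continuous_map_sum)
      show "continuous_map (nsphere (DIM('a) - Suc 0)) euclidean (\<lambda>y. y i *\<^sub>R (basis_enum i :: 'a))" for i
        using continuous_map_compose [OF continuous_map_nsphere_projection, of euclidean "\<lambda>t. t *\<^sub>R (basis_enum i :: 'a)"]
        by (simp add: o_def continuous_intros)
    qed simp
  qed (auto simp: topspace_nsphere_DIM)
  show "continuous_map (top_of_set (sphere (0::'a) 1)) (nsphere (DIM('a) - Suc 0)) to_nsphere"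
  proof -
    have "to_nsphere \<in> sphere (0::'a) 1 \<rightarrow> topspace (nsphere (DIM('a) - Suc 0))"
      unfolding topspace_nsphere_DIM by auto
    moreover have "continuous_map (top_of_set (sphere (0::'a) 1)) (powertop_real UNIV) to_nsphere"
      unfolding continuous_map_componentwise_UNIV to_nsphere_def
      by (auto intro!: continuous_intros)
    ultimately show ?thesis
      unfolding nsphere by (auto simp: continuous_map_in_subtopology Pi_iff)
  qed
qed (auto simp: topspace_nsphere_DIM)

definition sphere_degree :: "('a::euclidean_space \<Rightarrow> 'a) \<Rightarrow> int" where
  "sphere_degree f = Brouwer_degree2 (DIM('a) - Suc 0) (to_nsphere \<circ> f \<circ> from_nsphere)"

abbreviation sphere_map :: "('a::euclidean_space \<Rightarrow> 'a) \<Rightarrow> bool" where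
  "sphere_map f \<equiv> continuous_on (sphere 0 1) f \<and> f \<in> sphere 0 1 \<rightarrow> sphere 0 1"

lemma continuous_map_conjugate:
  fixes f :: "'a::euclidean_space \<Rightarrow> 'a"
  assumes "sphere_map f"
  shows "continuous_map (nsphere (DIM('a) - Suc 0)) (nsphere (DIM('a) - Suc 0)) (to_nsphere \<circ> f \<circ> from_nsphere)"
proof -
  note h = homeomorphic_maps_nsphere_sphere[where 'a='a, unfolded homeomorphic_maps_def]
  have "continuous_map (top_of_set (sphere (0::'a) 1)) (top_of_set (sphere (0::'a) 1)) f"
    using assms by auto
  then show ?thesis
    using h by (meson continuous_map_compose)
qed

lemma sphere_degree_cong:
  assumes "\<And>x. norm x = 1 \<Longrightarrow> f x = g x"
  shows "sphere_degree f = sphere_degree g"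
  unfolding sphere_degree_def
  by (rule Brouwer_degree2_eq) (use assms in \<open>auto simp: topspace_nsphere_DIM\<close>)

lemma sphere_degree_id: "sphere_degree (\<lambda>x. x) = 1"
proof -
  have "Brouwer_degree2 (DIM('a) - Suc 0) (to_nsphere \<circ> (\<lambda>x::'a. x) \<circ> from_nsphere) = Brouwer_degree2 (DIM('a) - Suc 0) id"
    by (rule Brouwer_degree2_eq) (auto simp: topspace_nsphere_DIM)
  then show ?thesis by (simp add: sphere_degree_def)
qed

lemma sphere_degree_const: "sphere_degree (\<lambda>x. c) = 0"
  by (simp add: sphere_degree_def o_def Brouwer_degree2_const)

lemma sphere_degree_compose:
  fixes f g :: "'a::euclidean_space \<Rightarrow> 'a"
  assumes "sphere_map f" "sphere_map g"
  shows "sphere_degree (\<lambda>x. g (f x)) = sphere_degree g * sphere_degree f"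
proof -
  have "Brouwer_degree2 (DIM('a) - Suc 0) (to_nsphere \<circ> (\<lambda>x. g (f x)) \<circ> from_nsphere) =
     Brouwer_degree2 (DIM('a) - Suc 0) ((to_nsphere \<circ> g \<circ> from_nsphere) \<circ> (to_nsphere \<circ> f \<circ> from_nsphere))"
    by (rule Brouwer_degree2_eq) (auto simp: topspace_nsphere_DIM)
  then show ?thesis
    using assms by (simp add: sphere_degree_def Brouwer_degree2_compose continuous_map_conjugate)
qed

lemma sphere_degree_homotopic:
  fixes f g :: "'a::euclidean_space \<Rightarrow> 'a"
  assumes "homotopic_with_canon (\<lambda>x. True) (sphere 0 1) (sphere 0 1) f g"
  shows "sphere_degree f = sphere_degree g"
proof -
  note h = homeomorphic_maps_nsphere_sphere[where 'a='a, unfolded homeomorphic_maps_def]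
  have "homotopic_with (\<lambda>x. True) (nsphere (DIM('a) - Suc 0)) (nsphere (DIM('a) - Suc 0))
     (to_nsphere \<circ> f \<circ> from_nsphere) (to_nsphere \<circ> g \<circ> from_nsphere)"
    by (rule homotopic_with_compose_continuous_map_right [OF
          homotopic_with_compose_continuous_map_left [OF assms]]) (use h in simp_all)
  then show ?thesis
    unfolding sphere_degree_def by (rule Brouwer_degree2_homotopic)
qed

lemma sphere_map_glue:
  fixes u v :: "'a::euclidean_space \<Rightarrow> 'a"
  assumes u: "sphere_map u" and v: "sphere_map v"
    and uv: "\<And>x. norm x = 1 \<Longrightarrow> x \<bullet> pole = 0 \<Longrightarrow> u x = v x"
  shows "sphere_map (\<lambda>x. if x \<bullet> pole \<ge> 0 then u x else v x)"
proof
  let ?A = "{x. norm x = 1 \<and> x \<bullet> pole \<ge> 0}" and ?B = "{x. norm x = 1 \<and> x \<bullet> pole \<le> 0}"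
  have eq: "?A = sphere 0 1 \<inter> {x. x \<bullet> pole \<ge> 0}" "?B = sphere 0 1 \<inter> {x. x \<bullet> pole \<le> 0}"
    by auto
  have cl: "closed ?A" "closed ?B"
    unfolding eq by (intro closed_Int closed_sphere closed_Collect_le continuous_intros)+
  have un: "sphere 0 1 = ?A \<union> ?B" by auto
  show "continuous_on (sphere 0 1) (\<lambda>x. if x \<bullet> pole \<ge> 0 then u x else v x)"
    unfolding un by (rule continuous_on_cases [OF cl])
      (use uv in \<open>auto intro: continuous_on_subset [OF conjunct1 [OF u]] continuous_on_subset [OF conjunct1 [OF v]]\<close>)
qed (use u v in \<open>auto simp: Pi_iff\<close>)

lemma sphere_degree_glue:
  fixes f g :: "'a::euclidean_space \<Rightarrow> 'a"
  assumes f: "sphere_map f" and g: "sphere_map g"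
    and eq: "\<And>x. norm x = 1 \<Longrightarrow> x \<bullet> pole = 0 \<Longrightarrow> f x = g x"
  shows "sphere_degree f + sphere_degree g =
      sphere_degree (\<lambda>x. if x \<bullet> pole \<ge> 0 then f x else g x) +
      sphere_degree (\<lambda>x. if x \<bullet> pole \<ge> 0 then g x else f x)"
proof -
  define F where "F = (\<lambda>i j. to_nsphere \<circ> (\<lambda>x. if x \<bullet> pole \<ge> 0 then if i then g x else f x
       else if j then g x else f x) \<circ> (from_nsphere :: _ \<Rightarrow> 'a))"
  have pole0: "from_nsphere y \<bullet> (pole :: 'a) = y 0" if "y \<in> topspace (nsphere (DIM('a) - Suc 0))" for y
    using that by (auto simp: topspace_nsphere_DIM to_nsphere_0)
  have "Brouwer_degree2 (DIM('a) - Suc 0) (F False False) + Brouwer_degree2 (DIM('a) - Suc 0) (F True True)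
       = Brouwer_degree2 (DIM('a) - Suc 0) (F False True) + Brouwer_degree2 (DIM('a) - Suc 0) (F True False)"
  proof (rule Brouwer_degree2_glue [where k = 0])
    show "continuous_map (nsphere (DIM('a) - Suc 0)) (nsphere (DIM('a) - Suc 0)) (F i j)" for i j
    proof -
      have ij: "sphere_map (\<lambda>x. if k then g x else f x)" for k
        using f g by (cases k) simp_all
      show ?thesis
        unfolding F_def by (rule continuous_map_conjugate, rule sphere_map_glue [OF ij ij]) (simp add: eq)
    qed
  next
    fix i x assume x: "x \<in> topspace (nsphere (DIM('a) - Suc 0))" "x 0 \<ge> 0"
    then show "F i True x = F i False x"
      by (simp add: F_def pole0)
  next
    fix j x assume x: "x \<in> topspace (nsphere (DIM('a) - Suc 0))" "x 0 \<le> 0"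
    then have "norm (from_nsphere x :: 'a) = 1"
      by (auto simp: topspace_nsphere_DIM)
    with x show "F True j x = F False j x"
      using pole0[OF x(1)] eq by (cases "x 0 = 0") (auto simp: F_def)
  qed
  then show ?thesis
    by (simp add: F_def sphere_degree_def cong: if_cong)
qed

section \<open>Extending equivariant maps\<close>

text \<open>
  For compact \<open>C\<close> and a sphere \<open>S\<close> this is equivalent to the covering dimension of \<open>C\<close> being at most the
  dimension of \<open>S\<close>.
\<close>

definition extends_into :: "'b::euclidean_space set \<Rightarrow> 'a::euclidean_space set \<Rightarrow> bool" where
  "extends_into C S \<longleftrightarrow> (\<forall>A f. closed A \<longrightarrow> A \<subseteq> C \<longrightarrow> continuous_on A f \<longrightarrow> f \<in> A \<rightarrow> S \<longrightarrow>
     (\<exists>g. continuous_on C g \<and> g \<in> C \<rightarrow> S \<and> (\<forall>x\<in>A. g x = f x)))"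

lemma extends_into_subset:
  assumes "extends_into D S" "C \<subseteq> D"
  shows "extends_into C S"
  unfolding extends_into_def
proof (intro allI impI)
  fix A f assume A: "closed A" "A \<subseteq> C" "continuous_on A f" "f \<in> A \<rightarrow> S"
  with assms have "A \<subseteq> D" by blast
  then obtain g where "continuous_on D g" "g \<in> D \<rightarrow> S" "\<forall>x\<in>A. g x = f x"
    using assms(1) A unfolding extends_into_def by metis
  then show "\<exists>g. continuous_on C g \<and> g \<in> C \<rightarrow> S \<and> (\<forall>x\<in>A. g x = f x)"
    using assms(2) by (meson continuous_on_subset Pi_anti_mono subsetD)
qed

lemma extends_into_homeomorphic:
  assumes hom: "homeomorphism C D h k" and "compact C" and D: "extends_into D S"
  shows "extends_into C S"
  unfolding extends_into_def
proof (intro allI impI)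
  fix A f assume A: "closed A" "A \<subseteq> C" "continuous_on A f" "f \<in> A \<rightarrow> S"
  have "compact A"
    using A \<open>compact C\<close> by (metis closed_Int_compact inf.absorb1)
  have h: "continuous_on C h" "h ` C = D" "\<And>x. x \<in> C \<Longrightarrow> k (h x) = x"
    and k: "continuous_on D k"
    using hom unfolding homeomorphism_def by auto
  have "compact (h ` A)"
    by (rule compact_continuous_image [OF continuous_on_subset [OF h(1) A(2)] \<open>compact A\<close>])
  then have cl: "closed (h ` A)" by (rule compact_imp_closed)
  have sub: "h ` A \<subseteq> D" using h A by blast
  have kim: "k ` h ` A = A"
    using h(3) A(2) by force
  have "continuous_on (h ` A) (f \<circ> k)"
    by (rule continuous_on_compose) (simp_all add: kim A continuous_on_subset [OF k sub])
  moreover have "f \<circ> k \<in> h ` A \<rightarrow> S"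
    using h(3) A(2,4) by (auto simp: Pi_iff subset_iff)
  ultimately obtain g where g: "continuous_on D g" "g \<in> D \<rightarrow> S" "\<forall>y\<in>h ` A. g y = (f \<circ> k) y"
    using D cl sub unfolding extends_into_def by metis
  have "continuous_on C (g \<circ> h)"
    by (rule continuous_on_compose) (simp_all add: h g)
  moreover have "g \<circ> h \<in> C \<rightarrow> S" using g h by auto
  moreover have "\<forall>x\<in>A. (g \<circ> h) x = f x" using g(3) h(3) A(2) by auto
  ultimately show "\<exists>g. continuous_on C g \<and> g \<in> C \<rightarrow> S \<and> (\<forall>x\<in>A. g x = f x)" by blast
qed

text \<open>
  Enclosing \<open>C\<close> in a polytope of the same dimension reduces the claim to the extension of maps over
  cell complexes whose dimension is at most that of the target sphere.
\<close>

lemma extends_into_sphere_low_dim: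
  fixes C :: "'b::euclidean_space set"
  assumes "compact C" "aff_dim C < int (DIM('a))"
  shows "extends_into C (sphere (0::'a::euclidean_space) 1)"
proof -
  obtain a where a: "C \<subseteq> cbox (-a) a"
    using compact_imp_bounded [OF assms(1)] bounded_subset_cbox_symmetric by blast
  define P where "P = cbox (-a) a \<inter> affine hull C"
  have "C \<subseteq> P" unfolding P_def using a by (simp add: hull_subset)
  have "polytope P"
    unfolding P_def by (intro polytope_Int_polyhedron polytope_interval polyhedron_affine_hull)
  have "aff_dim P \<le> aff_dim (affine hull C)"
    by (rule aff_dim_subset) (simp add: P_def)
  then have dimP: "aff_dim P < aff_dim (cball (0::'a) 1)"
    using assms(2) by (simp add: aff_dim_cball)
  have "extends_into P (sphere (0::'a) 1)"
    unfolding extends_into_def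
  proof (intro allI impI)
    fix A and f :: "'b \<Rightarrow> 'a" assume A: "closed A" "A \<subseteq> P" "continuous_on A f" "f \<in> A \<rightarrow> sphere 0 1"
    show "\<exists>g. continuous_on P g \<and> g \<in> P \<rightarrow> sphere 0 1 \<and> (\<forall>x\<in>A. g x = f x)"
    proof (rule extend_map_cell_complex_to_sphere [of "{P}" A "cball (0::'a) 1" f])
      fix g :: "'b \<Rightarrow> 'a"
      assume "continuous_on (\<Union>{P}) g" "g \<in> \<Union>{P} \<rightarrow> rel_frontier (cball 0 1)" "\<And>x. x \<in> A \<Longrightarrow> g x = f x"
      then show ?thesis by auto
    qed (use A \<open>polytope P\<close> dimP in \<open>auto simp: face_of_refl polytope_imp_convex\<close>)
  qed
  then show ?thesis using \<open>C \<subseteq> P\<close> by (rule extends_into_subset)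
qed

text \<open>
  A cap of radius less than 2 misses the point opposite to its centre, and the sphere without
  that point is homeomorphic to a hyperplane by stereographic projection.
\<close>

lemma extends_into_sphere_cap:
  fixes x :: "'a::euclidean_space"
  assumes "norm x = 1" "r < 2"
  shows "extends_into (sphere 0 1 \<inter> cball x r) (sphere (0::'a) 1)"
proof -
  let ?C = "sphere 0 1 \<inter> cball x r"
  let ?H = "{y::'a. x \<bullet> y = 0}"
  have x0: "x \<noteq> 0" using assms by auto
  have "(sphere 0 1 - {-x}) homeomorphic ?H"
    by (rule homeomorphic_punctured_sphere_hyperplane) (use assms x0 in auto)
  then obtain h k where hk: "homeomorphism (sphere 0 1 - {-x}) ?H h k"
    unfolding homeomorphic_def by blast
  have "dist x (-x) = 2"
  proof -
    have "x - (- x) = 2 *\<^sub>R x" by (simp add: scaleR_2)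
    then show ?thesis using assms by (simp add: dist_norm)
  qed
  then have sub: "?C \<subseteq> sphere 0 1 - {-x}"
    using assms by auto
  then have hom: "homeomorphism ?C (h ` ?C) h k"
    using hk by (auto intro: homeomorphism_of_subsets)
  have comp: "compact ?C"
    by (simp add: compact_Int)
  have "h ` ?C \<subseteq> ?H"
    using hk sub unfolding homeomorphism_def by blast
  then have "aff_dim (h ` ?C) \<le> aff_dim ?H" by (rule aff_dim_subset)
  also have "\<dots> < int (DIM('a))"
    using x0 by simp
  finally have "aff_dim (h ` ?C) < int (DIM('a))" .
  moreover have "compact (h ` ?C)"
    using hom comp unfolding homeomorphism_def by (metis compact_continuous_image)
  ultimately have "extends_into (h ` ?C) (sphere (0::'a) 1)"
    by (intro extends_into_sphere_low_dim)
  then show ?thesis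
    by (rule extends_into_homeomorphic [OF hom comp])
qed

locale finite_action =
  fixes X :: "'b::euclidean_space set" and act :: "'g::{finite,group_add} \<Rightarrow> 'b \<Rightarrow> 'b"
  assumes act_cont: "\<And>g. continuous_on X (act g)"
    and act_closed: "\<And>g x. x \<in> X \<Longrightarrow> act g x \<in> X"
    and act_zero: "\<And>x. x \<in> X \<Longrightarrow> act 0 x = x"
    and act_add: "\<And>g h x. x \<in> X \<Longrightarrow> act (g + h) x = act g (act h x)"
begin

lemma act_minus_cancel [simp]: "x \<in> X \<Longrightarrow> act (- g) (act g x) = x" "x \<in> X \<Longrightarrow> act g (act (- g) x) = x"
  by (simp_all add: act_zero flip: act_add)

end

text \<open>
  A continuous map of a compact set without fixed points moves all points by at least some positive
  distance. For a free action of a finite group this gives the scale at which a set is disjoint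
  from all its translates.
\<close>

lemma uniform_displacement:
  fixes X :: "'b::euclidean_space set" and act :: "'g::finite \<Rightarrow> 'b \<Rightarrow> 'b"
  assumes "compact X" and "\<And>g. continuous_on X (act g)"
  obtains d where "d > 0" "\<And>g x. (\<And>y. y \<in> X \<Longrightarrow> act g y \<noteq> y) \<Longrightarrow> x \<in> X \<Longrightarrow> d \<le> dist (act g x) x"
proof -
  have "\<exists>d>0. (\<forall>y\<in>X. act g y \<noteq> y) \<longrightarrow> (\<forall>x\<in>X. d \<le> dist (act g x) x)" for g
  proof (cases "(\<forall>y\<in>X. act g y \<noteq> y) \<and> X \<noteq> {}")
    case True
    have "continuous_on X (\<lambda>x. dist (act g x) x)"
      using assms(2) by (intro continuous_intros)
    then obtain z where "z \<in> X" "\<forall>x\<in>X. dist (act g z) z \<le> dist (act g x) x"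
      using continuous_attains_inf assms(1) True by blast
    then show ?thesis using True by (intro exI[of _ "dist (act g z) z"]) auto
  qed (auto intro: exI[of _ 1])
  then obtain D where D: "\<And>g. D g > (0::real)"
      "\<And>g x. (\<And>y. y \<in> X \<Longrightarrow> act g y \<noteq> y) \<Longrightarrow> x \<in> X \<Longrightarrow> D g \<le> dist (act g x) x"
    by metis
  show thesis
  proof
    show "Min (range D) > 0" using D(1) by (subst Min_gr_iff) auto
    show "Min (range D) \<le> dist (act g x) x" if "\<And>y. y \<in> X \<Longrightarrow> act g y \<noteq> y" "x \<in> X" for g x
    proof -
      have "Min (range D) \<le> D g" by (rule Min_le) auto
      also have "\<dots> \<le> dist (act g x) x" using that by (rule D(2))
      finally show ?thesis .
    qed
  qed
qed

locale equivariant_extension =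
  source: finite_action X act + target: finite_action S act'
  for X :: "'b::euclidean_space set" and act :: "'g::{finite,group_add} \<Rightarrow> 'b \<Rightarrow> 'b"
    and S :: "'a::euclidean_space set" and act' :: "'g \<Rightarrow> 'a \<Rightarrow> 'a" +
  assumes free: "\<And>g x. x \<in> X \<Longrightarrow> act g x = x \<Longrightarrow> g = 0"
    and compact: "compact X"
begin

definition invariant :: "'b set \<Rightarrow> bool" where
  "invariant A \<longleftrightarrow> closed A \<and> A \<subseteq> X \<and> (\<forall>g. \<forall>x\<in>A. act g x \<in> A)"

definition equivariant :: "'b set \<Rightarrow> ('b \<Rightarrow> 'a) \<Rightarrow> bool" where
  "equivariant A f \<longleftrightarrow> continuous_on A f \<and> f \<in> A \<rightarrow> S \<and> (\<forall>g. \<forall>x\<in>A. f (act g x) = act' g (f x))"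

text \<open>
  On a set \<open>C\<close> that is disjoint from its translates by nontrivial group elements, any extension will
  do; equivariance then dictates the values on the translates of \<open>C\<close>. On the overlap with \<open>A\<close> the
  two prescriptions agree because \<open>f\<close> is equivariant there.
\<close>

lemma extend_over_translates:
  assumes A: "invariant A" and f: "equivariant A f"
    and C: "closed C" "C \<subseteq> X" "extends_into C S"
    and disj: "\<And>g x. x \<in> C \<Longrightarrow> act g x \<in> C \<Longrightarrow> g = 0"
  shows "\<exists>f'. invariant (A \<union> (\<Union>g. act g ` C)) \<and> equivariant (A \<union> (\<Union>g. act g ` C)) f' \<and> (\<forall>x\<in>A. f' x = f x)"
proof -
  have A': "closed A" "A \<subseteq> X" "\<And>g x. x \<in> A \<Longrightarrow> act g x \<in> A"
    using A unfolding invariant_def by auto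
  have f': "continuous_on A f" "f \<in> A \<rightarrow> S" "\<And>g x. x \<in> A \<Longrightarrow> f (act g x) = act' g (f x)"
    using f unfolding equivariant_def by auto
  have "closed (A \<inter> C)" "A \<inter> C \<subseteq> C" "continuous_on (A \<inter> C) f" "f \<in> A \<inter> C \<rightarrow> S"
    using A' C f' by (auto intro: continuous_on_subset)
  then obtain u where u: "continuous_on C u" "u \<in> C \<rightarrow> S" "\<And>x. x \<in> A \<inter> C \<Longrightarrow> u x = f x"
    using C(3) unfolding extends_into_def by metis
  define F where "F = (\<lambda>x. if x \<in> A then f x else
      (let g = (THE g. act (- g) x \<in> C) in act' g (u (act (- g) x))))"
  have FA: "F x = f x" if "x \<in> A" for x using that by (simp add: F_def)
  have FC: "F (act g c) = act' g (u c)" if c: "c \<in> C" for g c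
  proof (cases "act g c \<in> A")
    case True
    have "c \<in> X" using c C by blast
    then have "c \<in> A" using A'(3)[OF True, of "-g"] by simp
    then show ?thesis using True c by (simp add: FA f' u)
  next
    case False
    have "c \<in> X" using c C by blast
    have "(THE h. act (- h) (act g c) \<in> C) = g"
    proof (rule the_equality)
      show "act (- g) (act g c) \<in> C" using \<open>c \<in> X\<close> c by simp
      fix h assume "act (- h) (act g c) \<in> C"
      then have "act (- h + g) c \<in> C" using \<open>c \<in> X\<close> by (simp only: source.act_add)
      then have "- h + g = 0" using disj c by blast
      then show "h = g" by (metis add.inverse_inverse minus_unique)
    qed
    then show ?thesis using False \<open>c \<in> X\<close> by (simp add: F_def)
  qed
  let ?B = "A \<union> (\<Union>g. act g ` C)"
  have "compact C" using C compact by (metis closed_Int_compact inf.absorb1)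
  have clg: "closed (act g ` C)" for g
    using \<open>compact C\<close> C(2) source.act_cont
    by (intro compact_imp_closed compact_continuous_image) (auto intro: continuous_on_subset)
  have inv: "invariant ?B"
    unfolding invariant_def
  proof (intro conjI)
    show "closed ?B" using A' clg by (intro closed_Un closed_UN) auto
    show "?B \<subseteq> X" using A' C source.act_closed by blast
    show "\<forall>g. \<forall>x\<in>?B. act g x \<in> ?B"
    proof (intro allI ballI)
      fix g x assume "x \<in> ?B"
      then show "act g x \<in> ?B"
      proof
        assume "x \<in> (\<Union>g. act g ` C)"
        then obtain h c where "c \<in> C" "x = act h c" by blast
        then have "act g x = act (g + h) c" using C by (simp add: source.act_add subset_iff)
        then show ?thesis using \<open>c \<in> C\<close> by blast
      qed (use A' in blast)
    qed
  qed
  have contg: "continuous_on (act g ` C) F" for g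
  proof -
    have sub: "act g ` C \<subseteq> X" using C source.act_closed by blast
    have im: "act (- g) ` act g ` C = C" using C by (force simp: image_image)
    have uim: "u ` C \<subseteq> S" using u(2) by auto
    have "continuous_on (act g ` C) (act' g \<circ> (u \<circ> act (- g)))"
    proof (intro continuous_on_compose)
      show "continuous_on (act g ` C) (act (- g))"
        using source.act_cont sub continuous_on_subset by blast
      show "continuous_on (act (- g) ` act g ` C) u" by (simp add: im u)
      have "(u \<circ> act (- g)) ` act g ` C = u ` C" using im by (metis image_comp)
      then show "continuous_on ((u \<circ> act (- g)) ` act g ` C) (act' g)"
        using target.act_cont uim continuous_on_subset by metis
    qed
    moreover have "(act' g \<circ> (u \<circ> act (- g))) x = F x" if "x \<in> act g ` C" for x
      using that C by (auto simp: FC subset_iff)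
    ultimately show ?thesis by (rule continuous_on_eq)
  qed
  have "continuous_on (\<Union>g. act g ` C) F"
    using contg clg continuous_on_closed_Union [of UNIV "\<lambda>g. act g ` C" F] by simp
  moreover have "continuous_on A F"
    using continuous_on_eq [OF f'(1)] by (simp add: FA)
  ultimately have cont: "continuous_on ?B F"
    using A'(1) clg by (intro continuous_on_closed_Un closed_UN) auto
  have "F \<in> ?B \<rightarrow> S"
    using f'(2) u(2) target.act_closed by (auto simp: FA FC Pi_iff)
  moreover have "F (act g x) = act' g (F x)" if "x \<in> ?B" for g x
    using that
  proof
    assume "x \<in> A" then show ?thesis by (simp add: FA A' f')
  next
    assume "x \<in> (\<Union>g. act g ` C)"
    then obtain h c where hc: "c \<in> C" "x = act h c" by blast
    then have "F (act g x) = F (act (g + h) c)" using C by (simp add: source.act_add subset_iff)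
    also have "\<dots> = act' (g + h) (u c)" by (rule FC [OF hc(1)])
    also have "\<dots> = act' g (act' h (u c))" using u(2) hc(1) by (intro target.act_add) auto
    finally show ?thesis by (simp add: FC hc)
  qed
  ultimately have "equivariant ?B F"
    using cont unfolding equivariant_def by blast
  with inv FA show ?thesis by blast
qed

text \<open>
  The space is covered by finitely many balls that are small in two respects: they are disjoint
  from their translates, and maps into \<open>S\<close> extend over them. The map is extended over the orbit of one
  ball after another.
\<close>

theorem extend_equivariantly:
  assumes A: "invariant A" and f: "equivariant A f"
    and local: "r > 0" "\<And>x. x \<in> X \<Longrightarrow> extends_into (X \<inter> cball x r) S"
  shows "\<exists>f'. equivariant X f' \<and> (\<forall>x\<in>A. f' x = f x)"
proof -
  obtain d where d: "d > 0" "\<And>g x. (\<And>y. y \<in> X \<Longrightarrow> act g y \<noteq> y) \<Longrightarrow> x \<in> X \<Longrightarrow> d \<le> dist (act g x) x"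
    by (rule uniform_displacement [where act = act, OF compact source.act_cont]) blast
  define e where "e = min r (d / 3)"
  have "e > 0" using d local by (simp add: e_def)
  obtain K where K: "finite K" "K \<subseteq> X" "X \<subseteq> (\<Union>x\<in>K. ball x e)"
  proof (rule compactE_image [OF compact, of X "\<lambda>x. ball x e"])
    show "X \<subseteq> (\<Union>x\<in>X. ball x e)" using \<open>e > 0\<close> by auto
  qed auto
  have small: "g = 0" if "y \<in> X \<inter> cball x e" "act g y \<in> X \<inter> cball x e" for g x y
  proof (rule ccontr)
    assume "g \<noteq> 0"
    then have "d \<le> dist (act g y) y" using d(2)[of g y] free that by auto
    also have "\<dots> \<le> dist x (act g y) + dist x y" by (metis dist_commute dist_triangle)
    also have "\<dots> \<le> 2 * e" using that by auto
    also have "\<dots> < d" using d(1) by (simp add: e_def min_def)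
    finally show False by simp
  qed
  have "\<exists>B f'. invariant B \<and> A \<union> (X \<inter> (\<Union>x\<in>K. ball x e)) \<subseteq> B \<and> equivariant B f' \<and> (\<forall>x\<in>A. f' x = f x)"
    using K(1,2)
  proof (induction K rule: finite_induct)
    case empty
    then show ?case using A f by auto
  next
    case (insert x K)
    then obtain B f' where B: "invariant B" "A \<union> (X \<inter> (\<Union>x\<in>K. ball x e)) \<subseteq> B" "equivariant B f'" "\<forall>x\<in>A. f' x = f x"
      by auto
    let ?C = "X \<inter> cball x e"
    have "extends_into ?C S"
      by (rule extends_into_subset [OF local(2)[of x]]) (use insert.prems in \<open>auto simp: e_def\<close>)
    moreover have "closed ?C" using compact by (simp add: closed_Int compact_imp_closed)
    ultimately obtain f'' where f'': "invariant (B \<union> (\<Union>g. act g ` ?C))" "equivariant (B \<union> (\<Union>g. act g ` ?C)) f''"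
        "\<forall>x\<in>B. f'' x = f' x"
      using extend_over_translates [OF B(1,3), of ?C] small by blast
    have "?C \<subseteq> (\<Union>g. act g ` ?C)"
    proof
      fix y assume y: "y \<in> ?C"
      then have "y = act 0 y" by (simp add: source.act_zero)
      then show "y \<in> (\<Union>g. act g ` ?C)" using y by blast
    qed
    moreover have "X \<inter> ball x e \<subseteq> ?C" by auto
    ultimately have "A \<union> (X \<inter> (\<Union>x\<in>insert x K. ball x e)) \<subseteq> B \<union> (\<Union>g. act g ` ?C)"
      using B(2) by blast
    moreover have "\<forall>x\<in>A. f'' x = f x" using f''(3) B(2,4) by auto
    ultimately show ?case using f''(1,2) by blast
  qed
  then obtain B f' where B: "invariant B" "A \<union> (X \<inter> (\<Union>x\<in>K. ball x e)) \<subseteq> B" "equivariant B f'" "\<forall>x\<in>A. f' x = f x"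
    by blast
  have "X \<subseteq> B" using B(2) K(3) by auto
  moreover have "B \<subseteq> X" using B(1) unfolding invariant_def by simp
  ultimately have "equivariant X f'" using B(3) by simp
  then show ?thesis using B(4) by (intro exI conjI)
qed

end

section \<open>The degree of odd and of even maps\<close>

text \<open>
  The numeral type \<open>2\<close> is the group of integers modulo 2.
\<close>

definition involution_action :: "('a \<Rightarrow> 'a) \<Rightarrow> 2 \<Rightarrow> 'a \<Rightarrow> 'a" where
  "involution_action \<sigma> g = (if g = 0 then id else \<sigma>)"

lemma involution_action_simps [simp]:
  "involution_action \<sigma> 0 = id" "involution_action \<sigma> 1 = \<sigma>"
  by (simp_all add: involution_action_def)

lemma two_cases: "g = 0 \<or> g = (1::2)"
  using exhaust_2 [of g] by auto

lemma two_eq_zero [simp]: "(2::2) = 0"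
  using exhaust_2 [of "0::2"] by simp

lemma neg_eq_self_iff [simp]: "- x = x \<longleftrightarrow> x = (0 :: 'a::real_vector)"
proof
  assume "- x = x"
  then have "2 *\<^sub>R x = 0" by (metis add.left_inverse scaleR_2)
  then show "x = 0" by simp
qed simp

lemma involution_action_add:
  assumes "\<sigma> (\<sigma> x) = x"
  shows "involution_action \<sigma> (g + h) x = involution_action \<sigma> g (involution_action \<sigma> h x)"
  using two_cases [of g] two_cases [of h] assms by auto

lemma finite_action_involution:
  assumes "continuous_on X \<sigma>" "\<sigma> \<in> X \<rightarrow> X" "\<And>x. x \<in> X \<Longrightarrow> \<sigma> (\<sigma> x) = x"
  shows "finite_action X (involution_action \<sigma>)"
proof
  fix g :: 2
  show "continuous_on X (involution_action \<sigma> g)"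
    using assms(1) by (simp add: involution_action_def)
  show "involution_action \<sigma> g x \<in> X" if "x \<in> X" for x
    using assms(2) that by (auto simp: involution_action_def)
qed (simp_all add: involution_action_add assms)

lemma finite_action_commuting_involutions:
  assumes "finite_action X (involution_action A)" "finite_action X (involution_action B)"
    and comm: "\<And>x. x \<in> X \<Longrightarrow> A (B x) = B (A x)"
  shows "finite_action X (\<lambda>(g, h) x. involution_action A g (involution_action B h x))"
proof -
  interpret A: finite_action X "involution_action A" by fact
  interpret B: finite_action X "involution_action B" by fact
  have comm': "involution_action A g (involution_action B h x) = involution_action B h (involution_action A g x)"
    if "x \<in> X" for g h x
    using that comm by (simp add: involution_action_def)
  show ?thesis
  proof
    fix g :: "2 \<times> 2"
    show "continuous_on X ((\<lambda>(g, h) x. involution_action A g (involution_action B h x)) g)"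
    proof (cases g)
      case (Pair a b)
      have "involution_action B b ` X \<subseteq> X" using B.act_closed by blast
      then have "continuous_on X (involution_action A a \<circ> involution_action B b)"
        using A.act_cont B.act_cont by (meson continuous_on_compose continuous_on_subset)
      then show ?thesis by (simp add: Pair o_def)
    qed
    show "(\<lambda>(g, h) x. involution_action A g (involution_action B h x)) (g + h) x =
        (\<lambda>(g, h) x. involution_action A g (involution_action B h x)) g
         ((\<lambda>(g, h) x. involution_action A g (involution_action B h x)) h x)" if "x \<in> X" for h x
    proof (cases g, cases h)
      fix a b c d assume g: "g = (a, b)" and h: "h = (c, d)"
      have "involution_action A (a + c) (involution_action B (b + d) x) =
         involution_action A a (involution_action A c (involution_action B b (involution_action B d x)))"
        using that by (simp add: A.act_add B.act_add B.act_closed)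
      also have "\<dots> = involution_action A a (involution_action B b (involution_action A c (involution_action B d x)))"
        using that by (simp add: comm' B.act_closed)
      finally show ?thesis by (simp add: g h)
    qed
  qed (auto simp: A.act_closed B.act_closed zero_prod_def)
qed

abbreviation sign_symmetric :: "real \<Rightarrow> ('a::euclidean_space \<Rightarrow> 'a) \<Rightarrow> bool" where
  "sign_symmetric c f \<equiv> (\<forall>x. norm x = 1 \<longrightarrow> f (- x) = c *\<^sub>R f x)"

lemma finite_action_sign:
  assumes "c = 1 \<or> c = (-1::real)"
  shows "finite_action (sphere (0::'a::euclidean_space) 1) (involution_action ((*\<^sub>R) c))"
  by (rule finite_action_involution) (use assms in \<open>auto intro: continuous_intros\<close>)

text \<open>
  The annulus \<open>X\<close> in the hyperplane of the equator is the product of the equator with an interval: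
  the point at distance \<open>1 + s\<close> from the origin stands for time \<open>s\<close>. In this picture an equivariant
  homotopy from \<open>f\<close> to \<open>g\<close> on the equator is an equivariant extension from the boundary to the
  annulus, whose dimension does not exceed that of the target sphere.
\<close>

lemma equator_homotopy:
  fixes f g :: "'a::euclidean_space \<Rightarrow> 'a"
  assumes f: "sphere_map f" "sign_symmetric c f" and g: "sphere_map g" "sign_symmetric c g"
    and c: "c = 1 \<or> c = -1"
  defines "X \<equiv> {x::'a. x \<bullet> pole = 0 \<and> 1 \<le> norm x \<and> norm x \<le> 2}"
  obtains F where "continuous_on X F" "F \<in> X \<rightarrow> sphere 0 1" "\<And>x. x \<in> X \<Longrightarrow> F (- x) = c *\<^sub>R F x"
    "\<And>x. x \<bullet> pole = 0 \<Longrightarrow> norm x = 1 \<Longrightarrow> F x = f x"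
    "\<And>x. x \<bullet> pole = 0 \<Longrightarrow> norm x = 1 \<Longrightarrow> F (2 *\<^sub>R x) = g x"
proof -
  let ?S = "sphere (0::'a) 1"
  have Xeq: "X = {x. x \<bullet> pole = 0} \<inter> {x. 1 \<le> norm x} \<inter> cball 0 2"
    by (auto simp: X_def)
  have "closed {x::'a. x \<bullet> pole = 0}" "closed {x::'a. 1 \<le> norm x}"
    by (intro closed_Collect_eq closed_Collect_le continuous_intros)+
  then have "compact X"
    unfolding Xeq by (intro closed_Int_compact closed_Int) auto
  have "finite_action X (involution_action uminus)"
    by (rule finite_action_involution) (auto simp: X_def intro: continuous_intros)
  then interpret finite_action X "involution_action uminus" .
  interpret equivariant_extension X "involution_action uminus" ?S "involution_action ((*\<^sub>R) c)"
  proof (intro equivariant_extension.intro equivariant_extension_axioms.intro)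
    show "finite_action ?S (involution_action ((*\<^sub>R) c))"
      using c by (rule finite_action_sign)
    show "g = 0" if "x \<in> X" "involution_action uminus g x = x" for g x
      using that two_cases [of g] by (auto simp: X_def)
  qed fact+
  let ?E = "{x::'a. x \<bullet> pole = 0 \<and> norm x = 1}" and ?E2 = "{x::'a. x \<bullet> pole = 0 \<and> norm x = 2}"
  define f0 where "f0 = (\<lambda>x. if norm x = 1 then f x else g (x /\<^sub>R 2))"
  have "closed ?E" "closed ?E2"
    by (intro closed_Collect_conj closed_Collect_eq continuous_intros)+
  then have inv: "invariant (?E \<union> ?E2)"
    using two_cases unfolding invariant_def by (auto simp: X_def involution_action_def)
  have "continuous_on (?E \<union> ?E2) f0"
    unfolding f0_def
  proof (rule continuous_on_cases [OF \<open>closed ?E\<close> \<open>closed ?E2\<close>])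
    show "continuous_on ?E f"
      by (rule continuous_on_subset [OF conjunct1 [OF f(1)]]) auto
    show "continuous_on ?E2 (\<lambda>x. g (x /\<^sub>R 2))"
      by (rule continuous_on_compose2 [OF conjunct1 [OF g(1)]]) (auto intro: continuous_intros)
  qed auto
  moreover have "f0 \<in> ?E \<union> ?E2 \<rightarrow> ?S"
    using f(1) g(1) by (auto simp: f0_def Pi_iff)
  moreover have "f0 (- x) = c *\<^sub>R f0 x" if "x \<in> ?E \<union> ?E2" for x
  proof (cases "norm x = 1")
    case False
    then have "norm (x /\<^sub>R 2) = 1" using that by auto
    then have "g (- (x /\<^sub>R 2)) = c *\<^sub>R g (x /\<^sub>R 2)" using g(2) by blast
    with False show ?thesis by (simp add: f0_def)
  qed (use f in \<open>simp add: f0_def\<close>)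
  ultimately have eqv: "equivariant (?E \<union> ?E2) f0"
    unfolding equivariant_def by (auto simp: involution_action_def)
  have loc: "extends_into (X \<inter> cball x 1) ?S" for x
  proof (rule extends_into_sphere_low_dim)
    show "compact (X \<inter> cball x 1)" using \<open>compact X\<close> by (simp add: compact_Int)
    have "aff_dim (X \<inter> cball x 1) \<le> aff_dim {x::'a. pole \<bullet> x = 0}"
      by (rule aff_dim_subset) (auto simp: X_def inner_commute)
    also have "\<dots> < int DIM('a)"
      by (simp add: aff_dim_hyperplane nonzero_Basis)
    finally show "aff_dim (X \<inter> cball x 1) < int DIM('a)" .
  qed
  obtain F where F: "equivariant X F" "\<forall>x\<in>?E \<union> ?E2. F x = f0 x"
    using extend_equivariantly [OF inv eqv zero_less_one loc] by blast
  show thesis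
  proof
    show "continuous_on X F" "F \<in> X \<rightarrow> ?S"
      using F(1) unfolding equivariant_def by auto
    show "F (- x) = c *\<^sub>R F x" if "x \<in> X" for x
    proof -
      have "F (involution_action uminus 1 x) = involution_action ((*\<^sub>R) c) 1 (F x)"
        using F(1) that unfolding equivariant_def by blast
      then show ?thesis by simp
    qed
    show "F x = f x" if "x \<bullet> pole = 0" "norm x = 1" for x
      using F(2) that by (simp add: f0_def)
    show "F (2 *\<^sub>R x) = g x" if "x \<bullet> pole = 0" "norm x = 1" for x
      using F(2) that by (simp add: f0_def)
  qed
qed

text \<open>
  An explicit homotopy extension. At time \<open>s\<close> the band of points whose height is at most \<open>s / 2\<close> in absolute value is
  collapsed to the equator along \<open>\<rho>\<close>, while the two remaining caps are stretched to full
  hemispheres, on which \<open>f\<close> is used. The freed band is filled with the homotopy \<open>F\<close> of the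
  equator, run for a time that decreases from \<open>s\<close> on the equator to 0 at the edge of the band. All
  formulas commute with the antipodal map, so the symmetry of \<open>f\<close> persists.
\<close>

lemma deform_on_equator:
  fixes f g :: "'a::euclidean_space \<Rightarrow> 'a"
  assumes f: "sphere_map f" "sign_symmetric c f" and g: "sphere_map g" "sign_symmetric c g"
    and c: "c = 1 \<or> c = -1"
  obtains f1 where "sphere_map f1" "sign_symmetric c f1" "sphere_degree f1 = sphere_degree f"
    "\<And>x. norm x = 1 \<Longrightarrow> x \<bullet> pole = 0 \<Longrightarrow> f1 x = g x"
proof -
  let ?S = "sphere (0::'a) 1"
  define X where "X = {x::'a. x \<bullet> pole = 0 \<and> 1 \<le> norm x \<and> norm x \<le> 2}"
  obtain F where F: "continuous_on X F" "F \<in> X \<rightarrow> sphere 0 1" "\<And>x. x \<in> X \<Longrightarrow> F (- x) = c *\<^sub>R F x"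
    "\<And>x. x \<bullet> pole = 0 \<Longrightarrow> norm x = 1 \<Longrightarrow> F x = f x"
    "\<And>x. x \<bullet> pole = 0 \<Longrightarrow> norm x = 1 \<Longrightarrow> F (2 *\<^sub>R x) = g x"
    by (rule equator_homotopy [OF f g c, folded X_def]) (rule that)
  \<comment> \<open>Subtracting \<open>\<kappa>\<close> from the height clamps heights in the band to 0.\<close>
  define \<kappa> where "\<kappa> = (\<lambda>s (x::'a). max (- (s / 2)) (min (s / 2) (x \<bullet> pole)))"
  define \<rho> where "\<rho> = (\<lambda>s x. sgn (x - \<kappa> s x *\<^sub>R pole))"
  define H where "H = (\<lambda>(s, x). if s / 2 \<le> \<bar>x \<bullet> pole\<bar> then f (\<rho> s x)
      else F ((1 + s - 2 * \<bar>x \<bullet> pole\<bar>) *\<^sub>R \<rho> s x))"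
  have pp: "(pole::'a) \<bullet> pole = 1" by (simp add: inner_same_Basis)
  have nz: "x - \<kappa> s x *\<^sub>R pole \<noteq> 0" if "norm x = 1" "s \<in> {0..1}" for s x
  proof
    assume "x - \<kappa> s x *\<^sub>R pole = 0"
    then have "x = \<kappa> s x *\<^sub>R pole" by simp
    then have "norm x = \<bar>\<kappa> s x\<bar>" by (metis norm_Basis norm_scaleR pole_in_Basis mult.right_neutral)
    moreover have "\<bar>\<kappa> s x\<bar> \<le> s / 2" using that by (auto simp: \<kappa>_def)
    ultimately show False using that by auto
  qed
  have \<rho>norm: "norm (\<rho> s x) = 1" if "norm x = 1" "s \<in> {0..1}" for s x
    using nz [OF that] by (simp add: \<rho>_def norm_sgn)
  have \<kappa>odd: "\<kappa> s (- x) = - \<kappa> s x" if "s \<in> {0..1}" for s x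
    using that by (auto simp: \<kappa>_def max_def min_def)
  have \<rho>odd: "\<rho> s (- x) = - \<rho> s x" if "s \<in> {0..1}" for s x
    by (simp add: \<rho>_def \<kappa>odd [OF that] flip: sgn_minus)
  have \<rho>eq: "\<rho> s x \<bullet> pole = 0" if "\<bar>x \<bullet> pole\<bar> \<le> s / 2" for s x
  proof -
    have "\<kappa> s x = x \<bullet> pole" using that by (auto simp: \<kappa>_def)
    then show ?thesis by (simp add: \<rho>_def sgn_div_norm inner_diff_left pp)
  qed
  have \<rho>id: "\<rho> s x = x" if "norm x = 1" "\<kappa> s x = 0" for s x
    using that by (simp add: \<rho>_def sgn_div_norm)
  have inX: "(1 + s - 2 * \<bar>x \<bullet> pole\<bar>) *\<^sub>R \<rho> s x \<in> X" if "norm x = 1" "s \<in> {0..1}" "\<bar>x \<bullet> pole\<bar> \<le> s / 2" for s x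
    using that \<rho>norm [OF that(1,2)] \<rho>eq [OF that(3)] by (auto simp: X_def)
  let ?D = "{0..1::real} \<times> ?S"
  let ?D1 = "{p \<in> ?D. fst p / 2 \<le> \<bar>snd p \<bullet> pole\<bar>}" and ?D2 = "{p \<in> ?D. \<bar>snd p \<bullet> pole\<bar> \<le> fst p / 2}"
  have clD: "closed ?D" by (intro closed_Times) auto
  have D1: "?D1 = ?D \<inter> {p. fst p / 2 \<le> \<bar>snd p \<bullet> pole\<bar>}" and D2: "?D2 = ?D \<inter> {p. \<bar>snd p \<bullet> pole\<bar> \<le> fst p / 2}"
    by auto
  have cl: "closed ?D1" "closed ?D2"
    unfolding D1 D2 by (auto intro!: closed_Int clD closed_Collect_le continuous_intros)
  have \<rho>cont: "continuous_on ?D (\<lambda>p. \<rho> (fst p) (snd p))"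
    unfolding \<rho>_def sgn_div_norm
  proof (intro continuous_intros)
    show "continuous_on ?D (\<lambda>p. \<kappa> (fst p) (snd p))"
      "continuous_on ?D (\<lambda>p. \<kappa> (fst p) (snd p))"
      unfolding \<kappa>_def by (auto intro!: continuous_intros)
    show "\<forall>p\<in>?D. norm (snd p - \<kappa> (fst p) (snd p) *\<^sub>R pole) \<noteq> 0"
      using nz by auto
  qed
  have Hcont: "continuous_on ?D H"
  proof -
    have un: "?D = ?D1 \<union> ?D2" by auto
    have "continuous_on (?D1 \<union> ?D2) (\<lambda>p. if fst p / 2 \<le> \<bar>snd p \<bullet> pole\<bar> then f (\<rho> (fst p) (snd p))
       else F ((1 + fst p - 2 * \<bar>snd p \<bullet> pole\<bar>) *\<^sub>R \<rho> (fst p) (snd p)))"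
    proof (rule continuous_on_cases [OF cl])
      show "continuous_on ?D1 (\<lambda>p. f (\<rho> (fst p) (snd p)))"
        by (rule continuous_on_compose2 [OF conjunct1 [OF f(1)]])
          (auto intro: continuous_on_subset [OF \<rho>cont] simp: \<rho>norm)
      show "continuous_on ?D2 (\<lambda>p. F ((1 + fst p - 2 * \<bar>snd p \<bullet> pole\<bar>) *\<^sub>R \<rho> (fst p) (snd p)))"
      proof (rule continuous_on_compose2 [OF F(1)])
        show "continuous_on ?D2 (\<lambda>p. (1 + fst p - 2 * \<bar>snd p \<bullet> pole\<bar>) *\<^sub>R \<rho> (fst p) (snd p))"
          by (intro continuous_intros continuous_on_subset [OF \<rho>cont]) auto
        show "(\<lambda>p. (1 + fst p - 2 * \<bar>snd p \<bullet> pole\<bar>) *\<^sub>R \<rho> (fst p) (snd p)) ` ?D2 \<subseteq> X"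
          using inX by auto
      qed
      show "\<forall>p. p \<in> ?D1 \<and> \<not> fst p / 2 \<le> \<bar>snd p \<bullet> pole\<bar> \<or> p \<in> ?D2 \<and> fst p / 2 \<le> \<bar>snd p \<bullet> pole\<bar> \<longrightarrow>
          f (\<rho> (fst p) (snd p)) = F ((1 + fst p - 2 * \<bar>snd p \<bullet> pole\<bar>) *\<^sub>R \<rho> (fst p) (snd p))"
      proof (intro allI impI)
        fix p assume "p \<in> ?D1 \<and> \<not> fst p / 2 \<le> \<bar>snd p \<bullet> pole\<bar> \<or> p \<in> ?D2 \<and> fst p / 2 \<le> \<bar>snd p \<bullet> pole\<bar>"
        then have p: "fst p \<in> {0..1}" "norm (snd p) = 1" "\<bar>snd p \<bullet> pole\<bar> = fst p / 2"
          by (auto simp: mem_Times_iff)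
        then have "F (\<rho> (fst p) (snd p)) = f (\<rho> (fst p) (snd p))"
          by (intro F(4) \<rho>eq \<rho>norm) auto
        moreover have "1 + fst p - 2 * \<bar>snd p \<bullet> pole\<bar> = 1"
          using p(3) by simp
        ultimately show "f (\<rho> (fst p) (snd p)) = F ((1 + fst p - 2 * \<bar>snd p \<bullet> pole\<bar>) *\<^sub>R \<rho> (fst p) (snd p))"
          by (simp only: scaleR_one)
      qed
    qed
    then show ?thesis
      unfolding H_def un [symmetric] by (simp add: case_prod_unfold)
  qed
  have HS: "H \<in> ?D \<rightarrow> ?S"
  proof
    fix p assume "p \<in> ?D"
    then obtain s x where p: "p = (s, x)" "s \<in> {0..1}" "norm x = 1" by auto
    show "H p \<in> ?S"
    proof (cases "s / 2 \<le> \<bar>x \<bullet> pole\<bar>")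
      case True
      then show ?thesis using f(1) \<rho>norm [OF p(3,2)] by (auto simp: H_def p Pi_iff)
    next
      case False
      then show ?thesis using F(2) inX [OF p(3,2)] by (auto simp: H_def p Pi_iff)
    qed
  qed
  have H0: "H (0, x) = f x" if "norm x = 1" for x
    using that by (simp add: H_def \<rho>id \<kappa>_def)
  define f1 where "f1 = (\<lambda>x. H (1, x))"
  have "homotopic_with_canon (\<lambda>x. True) ?S ?S (\<lambda>x. H (0, x)) f1"
    unfolding homotopic_with_def
  proof (intro exI [of _ H] conjI)
    show "continuous_map (prod_topology (top_of_set {0..1}) (top_of_set ?S)) (top_of_set ?S) H"
      using Hcont HS by auto
  qed (simp_all add: f1_def)
  then have "sphere_degree f1 = sphere_degree (\<lambda>x. H (0, x))"
    by (simp add: sphere_degree_homotopic)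
  also have "\<dots> = sphere_degree f"
    by (rule sphere_degree_cong) (rule H0)
  finally have deg: "sphere_degree f1 = sphere_degree f" .
  have f1cont: "continuous_on ?S f1"
    unfolding f1_def by (rule continuous_on_compose2 [OF Hcont]) (auto intro: continuous_intros)
  have f1S: "f1 \<in> ?S \<rightarrow> ?S"
    using HS by (auto simp: f1_def Pi_iff)
  have f1sym: "f1 (- x) = c *\<^sub>R f1 x" if x: "norm x = 1" for x
  proof (cases "1 / 2 \<le> \<bar>x \<bullet> pole\<bar>")
    case True
    then show ?thesis using f(2) \<rho>norm [OF x, of 1] by (simp add: f1_def H_def \<rho>odd)
  next
    case False
    then have "F (- ((1 + 1 - 2 * \<bar>x \<bullet> pole\<bar>) *\<^sub>R \<rho> 1 x)) = c *\<^sub>R F ((1 + 1 - 2 * \<bar>x \<bullet> pole\<bar>) *\<^sub>R \<rho> 1 x)"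
      by (intro F(3) inX x) auto
    with False show ?thesis by (simp add: f1_def H_def \<rho>odd)
  qed
  have f1g: "f1 x = g x" if "norm x = 1" "x \<bullet> pole = 0" for x
  proof -
    have "\<rho> 1 x = x" using that by (intro \<rho>id) (simp_all add: \<kappa>_def)
    then show ?thesis using F(5) [OF that(2,1)] that by (simp add: f1_def H_def)
  qed
  show thesis
    by (rule that [of f1]) (simp_all add: f1cont f1S f1sym f1g deg)
qed

text \<open>
  For \<open>c = -1\<close> and \<open>g\<close> the identity this is Borsuk's theorem that odd maps have odd degree; for
  \<open>c = 1\<close> and \<open>g\<close> constant it says that even maps have even degree. After \<open>f\<close> has been deformed to a map
  \<open>h\<close> that agrees with \<open>g\<close> on the equator, let \<open>k\<close> and \<open>k'\<close> arise from \<open>h\<close> and \<open>g\<close> by exchanging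
  them on the lower hemisphere. The symmetry gives \<open>k' x = c k (-x)\<close>, so \<open>k\<close> and \<open>k'\<close> have the same
  degree, and their total degree is that of \<open>h\<close> and \<open>g\<close>.
\<close>

theorem sign_symmetric_degree_parity:
  fixes f g :: "'a::euclidean_space \<Rightarrow> 'a"
  assumes f: "sphere_map f" "sign_symmetric c f" and g: "sphere_map g" "sign_symmetric c g"
    and c: "c = 1 \<or> c = -1"
    and antipode: "sphere_degree (uminus :: 'a \<Rightarrow> 'a) = 1"
  shows "even (sphere_degree f - sphere_degree g)"
proof -
  obtain h where h: "sphere_map h" "sign_symmetric c h" "sphere_degree h = sphere_degree f"
    "\<And>x. norm x = 1 \<Longrightarrow> x \<bullet> pole = 0 \<Longrightarrow> h x = g x"
    using deform_on_equator [OF f g c] by blast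
  define k where "k = (\<lambda>x. if x \<bullet> pole \<ge> 0 then h x else g x)"
  define k' where "k' = (\<lambda>x. if x \<bullet> pole \<ge> 0 then g x else h x)"
  have sum: "sphere_degree h + sphere_degree g = sphere_degree k + sphere_degree k'"
    unfolding k_def k'_def by (rule sphere_degree_glue) (use h g in auto)
  have kS: "sphere_map k"
    unfolding k_def by (rule sphere_map_glue) (use h g in auto)
  have anti: "sphere_map (uminus :: 'a \<Rightarrow> 'a)" by (auto intro: continuous_intros)
  have cc: "c * c = 1" using c by auto
  have "k' x = c *\<^sub>R k (- x)" if x: "norm x = 1" for x
  proof -
    have "c *\<^sub>R h (- x) = h x" "c *\<^sub>R g (- x) = g x"
      using h(2) g(2) x cc by simp_all
    then show ?thesis using h(4)[OF x] by (auto simp: k_def k'_def)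
  qed
  then have "sphere_degree k' = sphere_degree (\<lambda>x. c *\<^sub>R k (- x))"
    by (rule sphere_degree_cong)
  also have "\<dots> = sphere_degree ((*\<^sub>R) c :: 'a \<Rightarrow> 'a) * sphere_degree (\<lambda>x. k (- x))"
    by (rule sphere_degree_compose [of "\<lambda>x. k (- x)" "(*\<^sub>R) c :: 'a \<Rightarrow> 'a"])
      (use kS c in \<open>auto intro!: continuous_intros continuous_on_compose2 [OF conjunct1 [OF kS]] simp: Pi_iff\<close>)
  also have "sphere_degree (\<lambda>x. k (- x)) = sphere_degree k * sphere_degree (uminus :: 'a \<Rightarrow> 'a)"
    by (rule sphere_degree_compose [OF anti kS])
  also have "sphere_degree ((*\<^sub>R) c :: 'a \<Rightarrow> 'a) = 1"
    using c
  proof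
    assume "c = 1"
    then have "sphere_degree ((*\<^sub>R) c :: 'a \<Rightarrow> 'a) = sphere_degree (\<lambda>x::'a. x)"
      by (intro sphere_degree_cong) simp
    then show ?thesis by (simp add: sphere_degree_id)
  next
    assume "c = -1"
    then have "sphere_degree ((*\<^sub>R) c :: 'a \<Rightarrow> 'a) = sphere_degree (uminus :: 'a \<Rightarrow> 'a)"
      by (intro sphere_degree_cong) simp
    then show ?thesis by (simp add: antipode)
  qed
  finally have "sphere_degree f + sphere_degree g = 2 * sphere_degree k"
    using sum h(3) antipode by simp
  then show ?thesis by presburger
qed

section \<open>Free four-group actions on odd-dimensional spheres\<close>

text \<open>
  Scalar multiplication by \<open>e\<^sup>i\<^sup>t\<close> connects the identity with the antipodal map.
\<close>

lemma sphere_degree_antipode: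
  "sphere_degree (uminus :: complex^'n \<Rightarrow> complex^'n::finite) = 1"
proof -
  let ?S = "sphere (0 :: complex^'n) 1"
  define H :: "real \<times> (complex^'n) \<Rightarrow> complex^'n" where "H = (\<lambda>(t, z). \<chi> i. cis (pi * t) * z $ i)"
  have norm: "norm (H p) = norm (snd p)" for p
    by (simp add: H_def case_prod_unfold norm_vec_def norm_mult)
  have "homotopic_with_canon (\<lambda>x. True) ?S ?S (\<lambda>x. x) uminus"
    unfolding homotopic_with_def
  proof (intro exI [of _ H] conjI)
    have "continuous_on ({0..1} \<times> ?S) H"
      unfolding H_def case_prod_unfold by (intro continuous_intros)
    then show "continuous_map (prod_topology (top_of_set {0..1}) (top_of_set ?S)) (top_of_set ?S) H"
      using norm by auto
  qed (simp_all add: H_def vec_eq_iff)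
  then have "sphere_degree (\<lambda>x :: complex^'n. x) = sphere_degree (uminus :: complex^'n \<Rightarrow> complex^'n)"
    by (rule sphere_degree_homotopic)
  then show ?thesis by (simp add: sphere_degree_id)
qed

lemma equivariant_sphere_map_exists:
  fixes act :: "'g::{finite,group_add} \<Rightarrow> 'a::euclidean_space \<Rightarrow> 'a"
  assumes "finite_action (sphere 0 1) act" "finite_action (sphere 0 1) act'"
    and "\<And>g x. norm x = 1 \<Longrightarrow> act g x = x \<Longrightarrow> g = 0"
  obtains f where "sphere_map f" "\<And>g x. norm x = 1 \<Longrightarrow> f (act g x) = act' g (f x)"
proof -
  let ?S = "sphere (0::'a) 1"
  interpret equivariant_extension ?S act ?S act'
    using assms by (intro equivariant_extension.intro equivariant_extension_axioms.intro) auto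
  have 1: "invariant {}" and 2: "equivariant {} (\<lambda>x. x)"
    unfolding invariant_def equivariant_def by auto
  obtain f where "equivariant ?S f"
    using extend_equivariantly [OF 1 2 zero_less_one extends_into_sphere_cap] by auto
  then show thesis
    unfolding equivariant_def by (intro that [of f]) auto
qed

definition free_involution :: "('a::euclidean_space \<Rightarrow> 'a) \<Rightarrow> bool" where
  "free_involution A \<longleftrightarrow> sphere_map A \<and> (\<forall>x. norm x = 1 \<longrightarrow> A (A x) = x \<and> A x \<noteq> x)"

lemma free_involutionD:
  assumes "free_involution A"
  shows "sphere_map A" "\<And>x. norm x = 1 \<Longrightarrow> norm (A x) = 1"
    "\<And>x. norm x = 1 \<Longrightarrow> A (A x) = x" "\<And>x. norm x = 1 \<Longrightarrow> A x \<noteq> x"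
  using assms unfolding free_involution_def by (auto simp: Pi_iff)

lemma finite_action_free_involution:
  "free_involution A \<Longrightarrow> finite_action (sphere 0 1) (involution_action A)"
  by (rule finite_action_involution) (auto simp: free_involution_def)

text \<open>
  The number \<open>k\<close> is the degree of a map that carries the antipodal involution to \<open>A\<close>. Composing \<open>f\<close>
  with it turns the symmetry of \<open>f\<close> under \<open>A\<close> into a symmetry under the antipodal map, to which the
  parity theorem applies.
\<close>

lemma involution_degree_parity:
  fixes A :: "'a::euclidean_space \<Rightarrow> 'a"
  assumes A: "free_involution A"
    and antipode: "sphere_degree (uminus :: 'a \<Rightarrow> 'a) = 1"
  shows "\<exists>k. \<forall>f. sphere_map f \<longrightarrow>
     ((\<forall>x. norm x = 1 \<longrightarrow> f (A x) = f x) \<longrightarrow> even (sphere_degree f * k)) \<and>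
     ((\<forall>x. norm x = 1 \<longrightarrow> f (A x) = - f x) \<longrightarrow> odd (sphere_degree f * k))"
proof -
  obtain h where h: "sphere_map h" "\<And>g x. norm x = 1 \<Longrightarrow> h (involution_action uminus g x) = involution_action A g (h x)"
  proof (rule equivariant_sphere_map_exists)
    show "finite_action (sphere (0::'a) 1) (involution_action uminus)"
      by (rule finite_action_involution) (auto intro: continuous_intros)
    show "finite_action (sphere (0::'a) 1) (involution_action A)"
      using A by (rule finite_action_free_involution)
    show "g = 0" if "norm x = 1" "involution_action uminus g x = x" for g and x :: 'a
      using that two_cases [of g] by auto
  qed (rule that)
  have hA: "h (- x) = A (h x)" if "norm x = 1" for x
    using h(2) [OF that, of 1] by simp
  have him: "norm (h x) = 1" if "norm x = 1" for x
    using h(1) that by (auto simp: Pi_iff)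
  have fh: "sphere_map (\<lambda>x. f (h x))" if f: "sphere_map f" for f
    using f h(1) by (auto intro: continuous_on_compose2 [OF conjunct1 [OF f]] simp: Pi_iff him)
  obtain a :: 'a where a: "norm a = 1" using vector_choose_size zero_le_one by blast
  show ?thesis
  proof (intro exI [of _ "sphere_degree h"] allI impI conjI)
    fix f :: "'a \<Rightarrow> 'a"
    assume f: "sphere_map f" and fA: "\<forall>x. norm x = 1 \<longrightarrow> f (A x) = f x"
    have "even (sphere_degree (\<lambda>x. f (h x)) - sphere_degree (\<lambda>x::'a. a))"
      by (rule sign_symmetric_degree_parity [OF fh [OF f], where c = 1])
        (use a antipode in \<open>auto simp: hA fA him\<close>)
    then show "even (sphere_degree f * sphere_degree h)"
      by (simp add: sphere_degree_const sphere_degree_compose [OF h(1) f])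
  next
    fix f :: "'a \<Rightarrow> 'a"
    assume f: "sphere_map f" and fA: "\<forall>x. norm x = 1 \<longrightarrow> f (A x) = - f x"
    have "even (sphere_degree (\<lambda>x. f (h x)) - sphere_degree (\<lambda>x::'a. x))"
      by (rule sign_symmetric_degree_parity [OF fh [OF f], where c = "-1"])
        (use antipode in \<open>auto simp: hA fA him\<close>)
    then show "odd (sphere_degree f * sphere_degree h)"
      by (simp add: sphere_degree_id sphere_degree_compose [OF h(1) f])
  qed
qed

lemma commuting_free_involutions:
  assumes A: "free_involution A" and B: "free_involution B" and AB: "free_involution (\<lambda>x. A (B x))"
    and x: "norm x = 1"
  shows "A (B x) = B (A x)"
proof -
  note A' = free_involutionD [OF A] and B' = free_involutionD [OF B]
  have "A (B (A (B (B (A x))))) = B (A x)"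
    using free_involutionD(3) [OF AB, of "B (A x)"] A'(2) B'(2) x by simp
  then show ?thesis using A' B' x by simp
qed

text \<open>
  The four-group generated by \<open>A\<close> and \<open>B\<close> acts freely on the source. On the target it acts through
  the character that is trivial on \<open>A\<close> and \<open>-1\<close> on \<open>B\<close>.
\<close>

lemma signed_sphere_map_exists:
  fixes A B :: "'a::euclidean_space \<Rightarrow> 'a"
  assumes A: "free_involution A"
    and B: "free_involution B"
    and AB: "free_involution (\<lambda>x. A (B x))"
  obtains f where "sphere_map f" "\<And>x. norm x = 1 \<Longrightarrow> f (A x) = f x" "\<And>x. norm x = 1 \<Longrightarrow> f (B x) = - f x"
proof -
  let ?\<alpha> = "\<lambda>(g, h) x. involution_action A g (involution_action B h x)"
  let ?\<beta> = "\<lambda>(g, h) x. involution_action id g (involution_action (uminus :: 'a \<Rightarrow> 'a) h x)"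
  obtain f where f: "sphere_map f" "\<And>g x. norm x = 1 \<Longrightarrow> f (?\<alpha> g x) = ?\<beta> g (f x)"
  proof (rule equivariant_sphere_map_exists)
    show "finite_action (sphere 0 1) ?\<alpha>"
      by (rule finite_action_commuting_involutions [OF finite_action_free_involution [OF A] finite_action_free_involution [OF B]])
        (simp add: commuting_free_involutions [OF A B AB])
    show "finite_action (sphere (0::'a) 1) ?\<beta>"
      by (rule finite_action_commuting_involutions; (rule finite_action_involution)?)
        (auto intro: continuous_intros)
    show "g = 0" if x: "norm x = 1" and fixed: "?\<alpha> g x = x" for g x
    proof -
      obtain a b where g: "g = (a, b)" by (cases g)
      show ?thesis
        using fixed two_cases [of a] two_cases [of b] free_involutionD(4) [OF A x] free_involutionD(4) [OF B x]
          free_involutionD(4) [OF AB x]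
        by (auto simp: g zero_prod_def)
    qed
  qed (rule that)
  show thesis
  proof
    show "f (A x) = f x" if "norm x = 1" for x using f(2) [OF that, of "(1, 0)"] by simp
    show "f (B x) = - f x" if "norm x = 1" for x using f(2) [OF that, of "(0, 1)"] by simp
  qed (use f in auto)
qed

text \<open>
  The integer \<open>k\<close> belongs to \<open>A\<close> by \<open>involution_degree_parity\<close>. A map that is invariant under \<open>A\<close> and
  odd under \<open>B\<close> forces \<open>k\<close> to be even; a map that is odd under \<open>A\<close> forces it to be odd.
\<close>

theorem no_free_klein_four_action_on_sphere:
  fixes A B :: "complex^'n::finite \<Rightarrow> complex^'n"
  assumes A: "free_involution A"
    and B: "free_involution B"
    and AB: "free_involution (\<lambda>x. A (B x))"
  shows False
proof -
  obtain k where k: "\<And>f. sphere_map f \<Longrightarrow> \<forall>x. norm x = 1 \<longrightarrow> f (A x) = f x \<Longrightarrow> even (sphere_degree f * k)"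
    "\<And>f. sphere_map f \<Longrightarrow> \<forall>x. norm x = 1 \<longrightarrow> f (A x) = - f x \<Longrightarrow> odd (sphere_degree f * k)"
    using involution_degree_parity [OF A sphere_degree_antipode] by blast
  obtain l where l: "\<And>f. sphere_map f \<Longrightarrow> \<forall>x. norm x = 1 \<longrightarrow> f (B x) = - f x \<Longrightarrow> odd (sphere_degree f * l)"
    using involution_degree_parity [OF B sphere_degree_antipode] by blast
  obtain f where f: "sphere_map f" "\<And>x. norm x = 1 \<Longrightarrow> f (A x) = f x" "\<And>x. norm x = 1 \<Longrightarrow> f (B x) = - f x"
    by (rule signed_sphere_map_exists [OF A B AB]) (rule that)
  have "free_involution (\<lambda>x. B (A x))"
  proof -
    have "continuous_on (sphere 0 1) (\<lambda>x. B (A x))"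
      using free_involutionD(1) [OF A] free_involutionD(1) [OF B]
      by (intro continuous_on_compose2 [of "sphere 0 1" B "sphere 0 1" A]) auto
    moreover have "B (A (B (A x))) = x" if "norm x = 1" for x
      using commuting_free_involutions [OF A B AB, of "A x"] free_involutionD(2,3) [OF A] free_involutionD(3) [OF B] that
      by simp
    moreover have "B (A x) \<noteq> x" if "norm x = 1" for x
      using commuting_free_involutions [OF A B AB that] free_involutionD(4) [OF AB that] by simp
    ultimately show ?thesis
      using free_involutionD(2) [OF A] free_involutionD(2) [OF B]
      unfolding free_involution_def by (simp add: Pi_iff)
  qed
  then obtain f' where f': "sphere_map f'" "\<And>x. norm x = 1 \<Longrightarrow> f' (A x) = - f' x"
    by (rule signed_sphere_map_exists [OF B A]) (rule that)
  have "odd (sphere_degree f)" using l [OF f(1)] f(3) by simp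
  then have "even k" using k(1) [OF f(1)] f(2) by simp
  then show False using k(2) [OF f'(1)] f'(2) by simp
qed

section \<open>Lifting rotations from the lens space to the sphere\<close>

locale lens =
  fixes p :: nat and q :: "'n::finite \<Rightarrow> int"
  assumes p: "p > 0" and q: "\<And>i. coprime (q i) (int p)"
begin

definition deck :: "nat \<Rightarrow> complex^'n \<Rightarrow> complex^'n" where
  "deck k = lens_rotation p q ^^ k"

definition proj :: "complex^'n \<Rightarrow> (complex^'n) set" where
  "proj = orbit (integer_mod_group p) (lens_action p q)"

lemma norm_deck [simp]: "norm (deck k x) = norm x"
  by (simp add: deck_def norm_lens_rotation_funpow)

lemma deck_0 [simp]: "deck 0 x = x" and deck_add: "deck (j + k) x = deck j (deck k x)"
  by (simp_all add: deck_def funpow_add)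

lemma dist_deck [simp]: "dist (deck k x) (deck k y) = dist x y"
proof -
  have "deck k x - deck k y = deck k (x - y)"
    by (simp add: deck_def lens_rotation_funpow vec_eq_iff algebra_simps)
  then show ?thesis by (simp add: dist_norm)
qed

lemma continuous_deck: "continuous_on X (deck k)"
  unfolding continuous_on_iff by auto

lemma deck_mod: "deck (k mod p) x = deck k x"
  by (simp add: deck_def lens_rotation_funpow_mod [OF p])

lemma deck_mult_p [simp]: "p dvd k \<Longrightarrow> deck k x = x"
  using deck_mod [of k x] by simp

lemma deck_free:
  assumes "norm x = 1" "deck k x = x"
  shows "p dvd k"
proof -
  obtain i where i: "x $ i \<noteq> 0"
    using assms(1) by (metis norm_zero vec_eq_iff zero_index zero_neq_one)
  have "deck k x $ i = x $ i"
    using assms by simp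
  then have "exp (2 * of_real pi * \<i> / of_nat p) powi (q i * int k) = 1"
    using i by (simp add: deck_def lens_rotation_funpow)
  then have "int p dvd q i * int k"
    using p lens_root_powi_eq_1_iff by blast
  then show ?thesis
    using q [of i] by (simp add: coprime_commute coprime_dvd_mult_right_iff)
qed

lemma proj_eq:
  assumes "norm x = 1"
  shows "proj x = range (\<lambda>k. deck k x)"
proof -
  have "proj x = (\<lambda>k. deck (nat k) x) ` {0..<int p}"
    using assms p by (auto simp: proj_def orbit_def carrier_integer_mod_group lens_action_def deck_def)
  also have "\<dots> = range (\<lambda>k. deck k x)"
  proof (intro equalityI subsetI)
    fix y assume "y \<in> range (\<lambda>k. deck k x)"
    then obtain k where "y = deck k x" by blast
    then have "y = deck (nat (int (k mod p))) x"
      by (simp add: deck_mod)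
    then show "y \<in> (\<lambda>k. deck (nat k) x) ` {0..<int p}"
      using p by (intro image_eqI [of _ _ "int (k mod p)"]) auto
  qed auto
  finally show ?thesis .
qed

lemma proj_deck [simp]:
  assumes "norm x = 1"
  shows "proj (deck k x) = proj x"
proof -
  have "\<exists>j. deck i x = deck j (deck k x)" for i
  proof
    have "p dvd p * k" by simp
    then have "deck i x = deck i (deck (p * k) x)" by simp
    also have "\<dots> = deck (i + (p * k - k) + k) x"
    proof -
      have "k \<le> p * k" using p by simp
      then have "i + (p * k - k) + k = i + p * k" by linarith
      then show ?thesis by (simp only: deck_add)
    qed
    finally show "deck i x = deck (i + (p * k - k)) (deck k x)" by (simp add: deck_add)
  qed
  then show ?thesis
    using assms by (auto simp: proj_eq image_iff deck_add [symmetric])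
qed

lemma proj_eq_iff:
  assumes "norm x = 1"
  shows "norm y = 1 \<and> proj x = proj y \<longleftrightarrow> (\<exists>k. y = deck k x)"
proof
  assume "norm y = 1 \<and> proj x = proj y"
  then have "y \<in> proj x" using proj_eq [of y] rangeI [of "\<lambda>k. deck k y" 0] by simp
  then show "\<exists>k. y = deck k x" using proj_eq [OF assms] by auto
qed (use assms in auto)

lemma topspace_lens: "topspace (lens_space p q) = proj ` sphere 0 1"
  by (simp add: lens_space_def proj_def)

lemma continuous_proj: "continuous_map (top_of_set (sphere 0 1)) (lens_space p q) proj"
  unfolding lens_space_def proj_def
  by (rule quotient_imp_continuous_map [OF quotient_map_quotient_topology])

text \<open>
  The projection is open because the saturation of an open set is the union of its preimages under
  the deck transformations.
\<close>

lemma openin_proj: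
  assumes "open U"
  shows "openin (lens_space p q) (proj ` (sphere 0 1 \<inter> U))"
proof -
  have "{x \<in> sphere 0 1. proj x \<in> proj ` (sphere 0 1 \<inter> U)} = sphere 0 1 \<inter> (\<Union>k. deck k -` U)"
  proof (intro equalityI subsetI)
    fix x assume "x \<in> {x \<in> sphere 0 1. proj x \<in> proj ` (sphere 0 1 \<inter> U)}"
    then obtain y where "norm x = 1" "norm y = 1" "y \<in> U" "proj x = proj y" by auto
    then show "x \<in> sphere 0 1 \<inter> (\<Union>k. deck k -` U)"
      using proj_eq_iff [of x y] by auto
  next
    fix x assume "x \<in> sphere 0 1 \<inter> (\<Union>k. deck k -` U)"
    then obtain k where "norm x = 1" "deck k x \<in> U" by auto
    then show "x \<in> {x \<in> sphere 0 1. proj x \<in> proj ` (sphere 0 1 \<inter> U)}"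
      by (auto intro!: image_eqI [of _ _ "deck k x"])
  qed
  moreover have "open (\<Union>k. deck k -` U)"
    using assms continuous_deck by (intro open_UN ballI open_vimage)
  ultimately show ?thesis
    unfolding lens_space_def openin_quotient_topology
    by (auto simp: proj_def openin_open)
qed

text \<open>
  The points of one fibre keep a uniform distance from each other. This makes lifts that stay
  close to the starting point unique.
\<close>

lemma deck_displacement:
  obtains d where "d > 0" "\<And>x k. norm x = 1 \<Longrightarrow> dist (deck k x) x < d \<Longrightarrow> deck k x = x"
proof -
  have ex: "\<exists>d>0. \<forall>x. norm x = 1 \<longrightarrow> dist (deck k x) x < d \<longrightarrow> deck k x = x" for k
  proof (cases "p dvd k")
    case False
    let ?S = "sphere (0 :: complex^'n) 1"
    have "?S \<noteq> {}" by simp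
    moreover have "continuous_on ?S (\<lambda>x. dist (deck k x) x)"
      by (intro continuous_intros continuous_deck)
    ultimately obtain z where z: "z \<in> ?S" "\<forall>x\<in>?S. dist (deck k z) z \<le> dist (deck k x) x"
      using continuous_attains_inf [OF compact_sphere] by blast
    then have "dist (deck k z) z > 0" using deck_free [of z k] False by auto
    with z show ?thesis by (intro exI [of _ "dist (deck k z) z"]) (auto simp: not_less [symmetric])
  qed (auto intro: exI [of _ 1])
  then obtain D where D: "\<And>k. D k > (0::real)"
      "\<And>k x. norm x = 1 \<Longrightarrow> dist (deck k x) x < D k \<Longrightarrow> deck k x = x"
    by metis
  show thesis
  proof
    show "Min (D ` {..<p}) > 0" using D(1) p by (subst Min_gr_iff) auto
    fix x k assume x: "norm x = 1" "dist (deck k x) x < Min (D ` {..<p})"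
    have "Min (D ` {..<p}) \<le> D (k mod p)" using p by (intro Min_le) auto
    then show "deck k x = x"
      using D(2) [OF x(1), of "k mod p"] x(2) by (simp add: deck_mod)
  qed
qed

text \<open>
  The sets on which \<open>v\<close> is the translate of \<open>u\<close> by a given deck transformation are closed, finite in
  number and pairwise disjoint, and they cover the sphere. The sphere is connected, so one of
  them is everything. This includes the circle, which is why the argument also covers \<open>n = 1\<close>.
\<close>

lemma equal_proj_imp_deck:
  assumes u: "sphere_map u" and v: "sphere_map v"
    and eq: "\<And>x. norm x = 1 \<Longrightarrow> proj (u x) = proj (v x)"
  obtains k where "\<And>x. norm x = 1 \<Longrightarrow> v x = deck k (u x)"
proof -
  let ?S = "sphere (0 :: complex^'n) 1"
  define E where "E = (\<lambda>k. {x \<in> ?S. v x = deck k (u x)})"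
  have norms: "norm (u x) = 1" "norm (v x) = 1" if "norm x = 1" for x
    using u v that by (auto simp: Pi_iff)
  have closed_E: "closed (E k)" for k
  proof -
    have "continuous_on ?S (\<lambda>x. deck k (u x))"
      by (rule continuous_on_compose2 [OF continuous_deck [of UNIV] conjunct1 [OF u]]) simp
    then have "continuous_on ?S (\<lambda>x. v x - deck k (u x))"
      by (intro continuous_on_diff conjunct1 [OF v])
    then have "closed (?S \<inter> (\<lambda>x. v x - deck k (u x)) -` {0})"
      by (rule continuous_closed_preimage) simp_all
    moreover have "E k = ?S \<inter> (\<lambda>x. v x - deck k (u x)) -` {0}" by (auto simp: E_def)
    ultimately show ?thesis by simp
  qed
  have cover: "\<exists>k<p. x \<in> E k" if x: "norm x = 1" for x
  proof -
    obtain k where "v x = deck k (u x)"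
      using proj_eq_iff [of "u x" "v x"] eq [OF x] norms [OF x] by auto
    then have "v x = deck (k mod p) (u x)"
      by (simp add: deck_mod)
    then show ?thesis using x p by (intro exI [of _ "k mod p"]) (simp add: E_def)
  qed
  have disj: "j = k" if jk: "j < p" "k < p" and x: "x \<in> E j" "x \<in> E k" for j k x
  proof -
    have *: "b = a" if ab: "a \<le> b" "b < p" "deck a y = deck b y" "norm y = 1" for a b y
    proof -
      have "deck (b - a) (deck a y) = deck (b - a + a) y"
        by (simp only: deck_add)
      also have "\<dots> = deck a y"
        using ab by simp
      finally have "deck (b - a) (deck a y) = deck a y" .
      then have "p dvd b - a" by (intro deck_free [of "deck a y"]) (simp_all add: ab(4))
      moreover have "\<not> p dvd b - a" if "a < b"
        using ab that by (intro nat_dvd_not_less) auto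
      ultimately show ?thesis using ab(1) by (cases "a < b") auto
    qed
    have ux: "norm (u x) = 1" "deck j (u x) = deck k (u x)" using x norms by (auto simp: E_def)
    show ?thesis
    proof (cases "j \<le> k")
      case True
      then have "k = j" by (rule *) (fact jk ux)+
      then show ?thesis by simp
    next
      case False
      show ?thesis by (rule * [of k j "u x"]) (use False jk ux in simp_all)
    qed
  qed
  have "2 \<le> DIM(complex^'n)"
    using zero_less_card_finite [where 'a='n] by (simp only: DIM_cart DIM_complex)
  then have "connected ?S" by (rule connected_sphere)
  obtain a :: "complex^'n" where a: "norm a = 1" using vector_choose_size zero_le_one by blast
  obtain k where k: "k < p" "a \<in> E k" using cover [OF a] by blast
  let ?R = "\<Union>j\<in>{..<p} - {k}. E j"
  have "closed ?R" using closed_E by (intro closed_UN) auto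
  moreover have "?S \<subseteq> E k \<union> ?R"
  proof
    fix x assume "x \<in> ?S"
    then obtain j where "j < p" "x \<in> E j" using cover [of x] by auto
    then show "x \<in> E k \<union> ?R" by (cases "j = k") auto
  qed
  moreover have "E k \<inter> ?R \<inter> ?S = {}" using disj [OF k(1)] by auto
  ultimately have "E k \<inter> ?S = {} \<or> ?R \<inter> ?S = {}"
    using \<open>connected ?S\<close> closed_E [of k] by (intro connected_closedD)
  moreover have "a \<in> E k \<inter> ?S" using a k by simp
  ultimately have R: "?R \<inter> ?S = {}" by blast
  show thesis
  proof (rule that)
    fix x :: "complex^'n" assume x: "norm x = 1"
    obtain j where j: "j < p" "x \<in> E j" using cover [OF x] by blast
    have "j = k"
    proof (rule ccontr)
      assume "j \<noteq> k"
      then have "x \<in> ?R" using j by auto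
      then show False using R x by auto
    qed
    then show "v x = deck k (u x)" using j by (simp add: E_def)
  qed
qed

end

locale lens_SO3_action = lens p q for p and q :: "'n::finite \<Rightarrow> int" +
  fixes \<phi>
  assumes action: "continuous_action SO3 SO3_topology (lens_space p q) \<phi>"
    and free: "free_action SO3 (topspace (lens_space p q)) \<phi>"
    and p_odd: "odd p"
begin

lemma mult_SO3 [simp]: "x \<otimes>\<^bsub>SO3\<^esub> y = x ** y" and one_SO3 [simp]: "\<one>\<^bsub>SO3\<^esub> = mat 1"
  by (simp_all add: SO3_def)

lemma group_action_SO3: "group_action SO3 (proj ` sphere 0 1) \<phi>"
  using action unfolding continuous_action_def topspace_lens by simp

lemma action_mult:
  assumes "g \<in> carrier SO3" "h \<in> carrier SO3" "norm x = 1"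
  shows "\<phi> (g ** h) (proj x) = \<phi> g (\<phi> h (proj x))"
  using group_action.composition_rule [OF group_action_SO3, of "proj x" g h] assms by simp

lemma action_one: "norm x = 1 \<Longrightarrow> \<phi> (mat 1) (proj x) = proj x"
  using group_action.id_eq_one [OF group_action_SO3] by (metis imageI mem_sphere_0 one_SO3 restrict_apply')

lemma action_free:
  assumes "g \<in> carrier SO3" "norm x = 1" "\<phi> g (proj x) = proj x"
  shows "g = mat 1"
proof -
  have "g \<in> stabilizer SO3 \<phi> (proj x)"
    using assms by (simp add: stabilizer_def)
  moreover have "stabilizer SO3 \<phi> (proj x) = {mat 1}"
    using free assms(2) unfolding free_action_def topspace_lens by simp
  ultimately show ?thesis by simp
qed

text \<open>
  Commuting with the deck transformations is part of the definition: it holds for lifts of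
  rotations near the identity, is inherited by products, and makes the deck transformations central
  in the group of all lifts considered.
\<close>

definition lifts :: "real^3^3 \<Rightarrow> (complex^'n \<Rightarrow> complex^'n) \<Rightarrow> bool" where
  "lifts g A \<longleftrightarrow> g \<in> carrier SO3 \<and> sphere_map A \<and>
     (\<forall>x. norm x = 1 \<longrightarrow> proj (A x) = \<phi> g (proj x) \<and> (\<forall>k. A (deck k x) = deck k (A x)))"

lemma liftsD:
  assumes "lifts g A"
  shows "g \<in> carrier SO3" "sphere_map A" "\<And>x. norm x = 1 \<Longrightarrow> norm (A x) = 1"
    "\<And>x. norm x = 1 \<Longrightarrow> proj (A x) = \<phi> g (proj x)" "\<And>x k. norm x = 1 \<Longrightarrow> A (deck k x) = deck k (A x)"
  using assms unfolding lifts_def by (auto simp: Pi_iff)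

lemma lifts_mult:
  assumes A: "lifts g A" and B: "lifts h B"
  shows "lifts (g ** h) (\<lambda>x. A (B x))"
proof -
  note A' = liftsD [OF A] and B' = liftsD [OF B]
  have "g \<otimes>\<^bsub>SO3\<^esub> h \<in> carrier SO3"
    using A'(1) B'(1) by (intro monoid.m_closed group.is_monoid group_SO3)
  moreover have "continuous_on (sphere 0 1) (\<lambda>x. A (B x))"
    using A'(2) B'(2) by (intro continuous_on_compose2 [of "sphere 0 1" A "sphere 0 1" B]) auto
  ultimately show ?thesis
    unfolding lifts_def using A' B' by (simp add: action_mult Pi_iff)
qed

lemma lifts_one: "lifts (mat 1) (\<lambda>x. x)"
proof -
  have "\<one>\<^bsub>SO3\<^esub> \<in> carrier SO3" by (intro monoid.one_closed group.is_monoid group_SO3)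
  then show ?thesis by (simp add: lifts_def action_one)
qed

text \<open>
  Near \<open>(1, x)\<close> the image of \<open>x\<close> under the rotation still has a representative close to \<open>x\<close>, because the
  projection is open; compactness of the sphere makes the neighbourhood of the identity independent
  of \<open>x\<close>. The representative within distance \<open>\<delta>\<close> is unique, since two of them would be closer than
  the points of a fibre can be. Continuity and commutation with the deck transformations both
  follow from this uniqueness.
\<close>

lemma small_rotations_lift:
  obtains N where "openin SO3_topology N" "mat 1 \<in> N" "\<And>g. g \<in> N \<Longrightarrow> \<exists>A. lifts g A"
proof -
  let ?S = "sphere (0 :: complex^'n) 1"
  obtain d where d: "d > 0" "\<And>x k. norm x = 1 \<Longrightarrow> dist (deck k x) x < d \<Longrightarrow> deck k x = x"
    using deck_displacement by blast
  define \<delta> where "\<delta> = d / 2"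
  have "\<delta> > 0" using d(1) by (simp add: \<delta>_def)
  have uniq: "y = z" if yz: "norm y = 1" "norm z = 1" "proj y = proj z" "dist x y < \<delta>" "dist x z < \<delta>" for x y z
  proof -
    obtain k where k: "z = deck k y" using proj_eq_iff [of y z] yz by auto
    have "dist (deck k y) y \<le> dist x (deck k y) + dist x y" by (metis dist_commute dist_triangle)
    also have "\<dots> < d" using yz(4,5) k by (simp add: \<delta>_def)
    finally have "deck k y = y" by (rule d(2) [OF yz(1)])
    then show ?thesis by (simp add: k)
  qed
  define M where "M = (\<lambda>(g, x). \<phi> g (proj x))"
  have contM: "continuous_map (prod_topology SO3_topology (top_of_set ?S)) (lens_space p q) M"
  proof -
    have "continuous_map (prod_topology SO3_topology (top_of_set ?S))
        (prod_topology SO3_topology (lens_space p q)) (\<lambda>(g, x). (g, proj x))"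
      using continuous_map_prod_top [of SO3_topology "top_of_set ?S" SO3_topology "lens_space p q" "\<lambda>g. g" proj] continuous_proj
      by simp
    moreover have "continuous_map (prod_topology SO3_topology (lens_space p q)) (lens_space p q) (\<lambda>(g, x). \<phi> g x)"
      using action unfolding continuous_action_def by blast
    ultimately show ?thesis
      unfolding M_def by (auto dest: continuous_map_compose simp: o_def case_prod_unfold)
  qed
  have one: "mat 1 \<in> carrier SO3" using liftsD(1) [OF lifts_one] .
  have "\<exists>N U. openin SO3_topology N \<and> mat 1 \<in> N \<and> open U \<and> x \<in> U \<and>
      (\<forall>g\<in>N. \<forall>x'\<in>?S \<inter> U. \<exists>y\<in>?S. dist x' y < \<delta> \<and> proj y = \<phi> g (proj x'))" if x: "x \<in> ?S" for x
  proof -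
    let ?V = "proj ` (?S \<inter> ball x (\<delta> / 2))"
    let ?W = "{z \<in> topspace (prod_topology SO3_topology (top_of_set ?S)). M z \<in> ?V}"
    have "openin (prod_topology SO3_topology (top_of_set ?S)) ?W"
      by (rule openin_continuous_map_preimage [OF contM openin_proj [OF open_ball]])
    moreover have "(mat 1, x) \<in> ?W"
      using x one \<open>\<delta> > 0\<close> by (simp add: M_def action_one)
    ultimately obtain N U where NU: "openin SO3_topology N" "openin (top_of_set ?S) U" "mat 1 \<in> N" "x \<in> U" "N \<times> U \<subseteq> ?W"
      unfolding openin_prod_topology_alt by meson
    obtain U' where U': "open U'" "U = ?S \<inter> U'" using NU(2) by (auto simp: openin_open)
    have "\<exists>y\<in>?S. dist x' y < \<delta> \<and> proj y = \<phi> g (proj x')" if g: "g \<in> N" and x': "x' \<in> ?S \<inter> (U' \<inter> ball x (\<delta> / 2))" for g x'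
    proof -
      have "(g, x') \<in> ?W" using NU(5) g x' U' by blast
      then obtain y where y: "y \<in> ?S" "dist x y < \<delta> / 2" "proj y = \<phi> g (proj x')"
        by (auto simp: M_def)
      have "dist x' y \<le> dist x x' + dist x y" by (metis dist_commute dist_triangle)
      also have "\<dots> < \<delta>" using y(2) x' by auto
      finally show ?thesis using y by blast
    qed
    then show ?thesis
      using NU U' x \<open>\<delta> > 0\<close> by (intro exI [of _ N] exI [of _ "U' \<inter> ball x (\<delta> / 2)"]) auto
  qed
  then obtain N U where NU: "\<And>x. x \<in> ?S \<Longrightarrow> openin SO3_topology (N x) \<and> mat 1 \<in> N x \<and> open (U x) \<and> x \<in> U x \<and>
      (\<forall>g\<in>N x. \<forall>x'\<in>?S \<inter> U x. \<exists>y\<in>?S. dist x' y < \<delta> \<and> proj y = \<phi> g (proj x'))"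
    by metis
  obtain K where K: "K \<subseteq> ?S" "finite K" "?S \<subseteq> (\<Union>x\<in>K. U x)"
  proof (rule compactE_image [OF compact_sphere, of ?S U])
    show "?S \<subseteq> (\<Union>x\<in>?S. U x)" using NU by blast
  qed (use NU in auto)
  have "?S \<noteq> {}" by simp
  then have "K \<noteq> {}" using K by auto
  show thesis
  proof
    show "openin SO3_topology (\<Inter>x\<in>K. N x)"
      using K NU \<open>K \<noteq> {}\<close> by (intro openin_Inter) auto
    show "mat 1 \<in> (\<Inter>x\<in>K. N x)" using K NU by blast
  next
    fix g assume g: "g \<in> (\<Inter>x\<in>K. N x)"
    have gS: "g \<in> carrier SO3"
    proof -
      obtain x where "x \<in> K" using \<open>K \<noteq> {}\<close> by blast
      then have "openin SO3_topology (N x)" "g \<in> N x" using NU K g by auto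
      then show ?thesis using openin_subset by fastforce
    qed
    have "\<exists>y\<in>?S. dist x y < \<delta> \<and> proj y = \<phi> g (proj x)" if x: "x \<in> ?S" for x
    proof -
      obtain z where "z \<in> K" "x \<in> U z" using K(3) x by blast
      then show ?thesis using NU [of z] K(1) g x by blast
    qed
    then obtain A where A: "\<And>x. x \<in> ?S \<Longrightarrow> A x \<in> ?S \<and> dist x (A x) < \<delta> \<and> proj (A x) = \<phi> g (proj x)"
      by metis
    have "continuous_on ?S A"
      unfolding continuous_on_iff
    proof (intro ballI allI impI)
      fix x and e :: real assume x: "x \<in> ?S" and e: "e > 0"
      \<comment> \<open>Points within \<open>e'\<close> of \<open>A x\<close> are still closer than \<open>\<delta>\<close> to every point within \<open>e'\<close> of \<open>x\<close>.\<close>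
      define e' where "e' = min e ((\<delta> - dist x (A x)) / 2)"
      have "e' \<le> (\<delta> - dist x (A x)) / 2" unfolding e'_def by (rule min.cobounded2)
      moreover have half: "t + 2 * s \<le> c" if "s \<le> (c - t) / 2" for c s t :: real
        using that by (simp add: field_simps)
      ultimately have e'3: "dist x (A x) + 2 * e' \<le> \<delta>" by (intro half)
      have e': "e' > 0" "e' \<le> e" using A [OF x] e by (simp_all add: e'_def)
      let ?V = "proj ` (?S \<inter> ball (A x) e')"
      have "continuous_map (top_of_set ?S) (prod_topology SO3_topology (top_of_set ?S)) (\<lambda>x. (g, x))"
        by (rule continuous_map_pairedI) (simp_all add: gS)
      then have "continuous_map (top_of_set ?S) (lens_space p q) (M \<circ> (\<lambda>x. (g, x)))"
        using contM by (rule continuous_map_compose)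
      then have "openin (top_of_set ?S) {x' \<in> topspace (top_of_set ?S). (M \<circ> (\<lambda>x. (g, x))) x' \<in> ?V}"
        by (rule openin_continuous_map_preimage) (rule openin_proj [OF open_ball])
      moreover have "x \<in> {x' \<in> topspace (top_of_set ?S). (M \<circ> (\<lambda>x. (g, x))) x' \<in> ?V}"
        using x A [OF x] e'(1) by (auto simp: M_def intro!: image_eqI [of _ _ "A x"])
      ultimately obtain r where r: "r > 0"
        "ball x r \<inter> ?S \<subseteq> {x' \<in> topspace (top_of_set ?S). (M \<circ> (\<lambda>x. (g, x))) x' \<in> ?V}"
        unfolding openin_contains_ball by meson
      have r': "\<phi> g (proj x') \<in> ?V" if "x' \<in> ?S" "dist x' x < r" for x'
      proof -
        have "x' \<in> ball x r \<inter> ?S" using that by (simp add: dist_commute)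
        then show ?thesis using r(2) by (auto simp: M_def)
      qed
      show "\<exists>r>0. \<forall>x'\<in>?S. dist x' x < r \<longrightarrow> dist (A x') (A x) < e"
      proof (intro exI [of _ "min r e'"] conjI ballI impI)
        fix x' assume x': "x' \<in> ?S" "dist x' x < min r e'"
        then obtain y where y: "y \<in> ?S" "dist (A x) y < e'" "proj y = \<phi> g (proj x')"
          using r' [of x'] by auto
        have "dist x' y \<le> dist x' x + (dist x (A x) + dist (A x) y)"
          by (meson add_left_mono dist_triangle order_trans)
        also have "\<dots> < \<delta>" using x'(2) y(2) e'3 by simp
        finally have "y = A x'"
          using uniq [of y "A x'" x'] A [OF x'(1)] y by simp
        then show "dist (A x') (A x) < e" using y(2) e'(2) by (simp add: dist_commute)
      qed (use r e' in auto)
    qed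
    moreover have "A (deck k x) = deck k (A x)" if "norm x = 1" for k x
      using A [of x] A [of "deck k x"] that by (intro uniq [of _ _ "deck k x"]) auto
    ultimately have "lifts g A"
      unfolding lifts_def using gS A by (auto simp: Pi_iff)
    then show "\<exists>A. lifts g A" by blast
  qed
qed

end

context lens_SO3_action
begin

text \<open>
  The square of a lift \<open>A\<close> is a deck transformation, say the \<open>k\<close>-th power of the generator. With
  \<open>p = 2 j + 1\<close>, multiplying \<open>A\<close> by the power \<open>j k\<close> changes the square to the power \<open>p k\<close>, which is
  the identity.
\<close>

lemma lifts_free_involution:
  assumes A: "lifts g A" and g: "g ** g = mat 1" "g \<noteq> mat 1"
  obtains A' where "lifts g A'" "free_involution A'"
proof -
  note A' = liftsD [OF A]
  obtain k where k: "\<And>x. norm x = 1 \<Longrightarrow> A (A x) = deck k x"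
  proof (rule equal_proj_imp_deck)
    show "sphere_map (\<lambda>x::complex^'n. x)" by auto
    show AA: "sphere_map (\<lambda>x. A (A x))"
      using liftsD(2) [OF lifts_mult [OF A A]] .
    show "proj x = proj (A (A x))" if "norm x = 1" for x
      using liftsD(4) [OF lifts_mult [OF A A] that] that by (simp add: g action_one)
  qed (rule that)
  obtain j where j: "p = 2 * j + 1" using p_odd by (elim oddE)
  let ?A = "\<lambda>x. A (deck (j * k) x)"
  have "continuous_on (sphere 0 1) ?A"
    by (rule continuous_on_compose2 [OF conjunct1 [OF A'(2)] continuous_deck]) auto
  moreover have "?A (deck i x) = deck i (?A x)" if "norm x = 1" for i x
  proof -
    have "deck (j * k) (deck i x) = deck i (deck (j * k) x)"
      by (simp add: add.commute flip: deck_add)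
    then show ?thesis using that by (simp add: A'(5))
  qed
  ultimately have lift: "lifts g ?A"
    using A' unfolding lifts_def by (simp add: Pi_iff)
  have "?A (?A x) = x" if x: "norm x = 1" for x
  proof -
    have "?A (?A x) = deck (j * k) (deck (j * k) (A (A x)))"
      using x A' by simp
    also have "\<dots> = deck (j * k + (j * k + k)) x"
      using x by (simp add: k deck_add)
    also have "j * k + (j * k + k) = p * k" by (simp add: j algebra_simps)
    finally show ?thesis by simp
  qed
  moreover have "?A x \<noteq> x" if x: "norm x = 1" for x
    using action_free [OF A'(1) x] liftsD(4) [OF lift x] g(2) by force
  ultimately have "free_involution ?A"
    using liftsD(2) [OF lift] unfolding free_involution_def by simp
  then show thesis using lift that by blast
qed

text \<open>
  The composite \<open>A B A B\<close> is a deck transformation. Conjugating it with \<open>A\<close> gives its inverse \<open>B A B A\<close>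
  because \<open>A\<close> and \<open>B\<close> are involutions, but it also gives the same deck transformation because
  deck transformations commute with \<open>A\<close>. So its square is trivial, and it is trivial itself as \<open>p\<close> is odd.
\<close>

lemma lifts_product_free_involution:
  assumes A: "lifts g A" "free_involution A" and B: "lifts h B" "free_involution B"
    and gh: "g ** h = h ** g" "g ** h \<noteq> mat 1"
  shows "free_involution (\<lambda>x. A (B x))"
proof -
  note A' = liftsD [OF A(1)] and B' = liftsD [OF B(1)]
  note AA = free_involutionD(3) [OF A(2)] and BB = free_involutionD(3) [OF B(2)]
  note AB = liftsD [OF lifts_mult [OF A(1) B(1)]] and BA = liftsD [OF lifts_mult [OF B(1) A(1)]]
  obtain k where k: "\<And>x. norm x = 1 \<Longrightarrow> A (B x) = deck k (B (A x))"
  proof (rule equal_proj_imp_deck [OF BA(2) AB(2)])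
    show "proj (B (A x)) = proj (A (B x))" if "norm x = 1" for x
      using AB(4) [OF that] BA(4) [OF that] gh(1) by simp
  qed (rule that)
  have ABAB: "A (B (A (B x))) = deck k x" if x: "norm x = 1" for x
    using k [of "A (B x)"] AA [of "B x"] BB [OF x] A'(3) B'(3) x by simp
  have BABA: "B (A (B (A x))) = deck k x" if x: "norm x = 1" for x
  proof -
    have "A (A (B (A (B (A x))))) = A (deck k (A x))"
      using ABAB [of "A x"] A'(3) x by simp
    then show ?thesis
      using AA A'(3,5) B'(3) x by simp
  qed
  obtain a :: "complex^'n" where a: "norm a = 1" using vector_choose_size zero_le_one by blast
  have "deck (k + k) a = A (B (A (B (B (A (B (A a)))))))"
    using ABAB [of "deck k a"] BABA [OF a] a by (simp add: deck_add)
  also have "\<dots> = a"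
    using AA BB A'(3) B'(3) a by simp
  finally have "p dvd 2 * k" using deck_free [OF a] by (simp add: mult_2)
  then have "p dvd k"
    using p_odd by (simp add: coprime_dvd_mult_right_iff)
  then have "A (B (A (B x))) = x" if "norm x = 1" for x
    using ABAB [OF that] by simp
  moreover have "A (B x) \<noteq> x" if x: "norm x = 1" for x
    using action_free [OF AB(1) x] AB(4) [OF x] gh(2) by force
  ultimately show ?thesis
    using AB(2) unfolding free_involution_def by simp
qed

end

section \<open>Half turns about the coordinate axes\<close>

text \<open>
  The rotation by the angle \<open>t\<close> about the \<open>k\<close>-th coordinate axis. The listed index pairs are those in
  cyclic order, which fixes the sense of rotation in the plane of the other two axes.
\<close>

definition axis_rotation :: "3 \<Rightarrow> real \<Rightarrow> real^3^3" where
  "axis_rotation k t = (\<chi> i j. if i = k \<or> j = k then if i = j then 1 else 0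
     else if i = j then cos t else if (i, j) \<in> {(1, 2), (2, 3), (3, 1)} then - sin t else sin t)"

lemma axis_rotation_add: "axis_rotation k (s + t) = axis_rotation k s ** axis_rotation k t"
  using exhaust_3 [of k]
  by (auto simp: axis_rotation_def vec_eq_iff forall_3 matrix_matrix_mult_def sum_3 cos_add sin_add)

lemma axis_rotation_0 [simp]: "axis_rotation k 0 = mat 1"
  by (auto simp: axis_rotation_def vec_eq_iff mat_def)

lemma transpose_axis_rotation: "transpose (axis_rotation k t) = axis_rotation k (- t)"
  using exhaust_3 [of k]
  by (auto simp: axis_rotation_def vec_eq_iff forall_3 transpose_def)

lemma axis_rotation_in_SO3: "axis_rotation k t \<in> carrier SO3"
proof -
  have "orthogonal_matrix (axis_rotation k t)"
    unfolding orthogonal_matrix_def transpose_axis_rotation by (simp flip: axis_rotation_add)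
  moreover have "det (axis_rotation k t) = 1"
    using exhaust_3 [of k] sin_cos_squared_add [of t]
    by (auto simp: det_3 axis_rotation_def power2_eq_square algebra_simps)
  ultimately show ?thesis by (simp add: SO3_def rotation_matrix_def)
qed

lemma continuous_axis_rotation: "continuous_on UNIV (axis_rotation k)"
proof -
  have "continuous_on UNIV (\<lambda>t::real. if a then if b then 1 else 0
      else if b then cos t else if c then - sin t else sin t)" for a b c
    by (cases a; cases b; cases c) (simp_all add: continuous_intros)
  then have "continuous_on UNIV (\<lambda>t. axis_rotation k t $ i $ j)" for i j
    unfolding axis_rotation_def vec_lambda_beta .
  then have "continuous_on UNIV (\<lambda>t. \<chi> i j. axis_rotation k t $ i $ j)"
    by (intro continuous_on_vec_lambda)
  then show ?thesis by simp
qed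

lemma half_turns:
  "axis_rotation k pi ** axis_rotation k pi = mat 1" "axis_rotation k pi \<noteq> mat 1"
  "axis_rotation 1 pi ** axis_rotation 3 pi = axis_rotation 3 pi ** axis_rotation 1 pi"
  "axis_rotation 1 pi ** axis_rotation 3 pi \<noteq> mat 1"
proof -
  show "axis_rotation k pi ** axis_rotation k pi = mat 1"
    unfolding axis_rotation_add [symmetric] by (auto simp: axis_rotation_def vec_eq_iff mat_def)
  show "axis_rotation k pi \<noteq> mat 1"
    using exhaust_3 [of k] by (auto simp: axis_rotation_def vec_eq_iff forall_3 mat_def)
  show "axis_rotation 1 pi ** axis_rotation 3 pi = axis_rotation 3 pi ** axis_rotation 1 pi"
    by (simp add: axis_rotation_def vec_eq_iff forall_3 matrix_matrix_mult_def sum_3)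
  show "axis_rotation 1 pi ** axis_rotation 3 pi \<noteq> mat 1"
    by (simp add: axis_rotation_def vec_eq_iff forall_3 matrix_matrix_mult_def sum_3 mat_def)
qed

text \<open>
  A rotation by \<open>t\<close> is the \<open>m\<close>-th power of the rotation by \<open>t / m\<close>, which is as close to the identity as
  required once \<open>m\<close> is large.
\<close>

lemma (in lens_SO3_action) axis_rotation_lifts: "\<exists>A. lifts (axis_rotation k t) A"
proof -
  obtain N where N: "openin SO3_topology N" "mat 1 \<in> N" "\<And>g. g \<in> N \<Longrightarrow> \<exists>A. lifts g A"
    using small_rotations_lift by blast
  obtain U where U: "open U" "N = carrier SO3 \<inter> U"
    using N(1) unfolding SO3_topology_def openin_open by blast
  have "open (axis_rotation k -` U)"
    by (rule open_vimage [OF U(1) continuous_axis_rotation])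
  moreover have "0 \<in> axis_rotation k -` U" using N(2) U(2) by simp
  ultimately obtain e where e: "e > 0" "ball 0 e \<subseteq> axis_rotation k -` U"
    using open_contains_ball by blast
  obtain m where m: "\<bar>t\<bar> / e < real m" using reals_Archimedean2 by blast
  have "m > 0" using m e(1) by (metis abs_ge_zero divide_nonneg_pos gr0I not_less of_nat_0)
  then have "\<bar>t / real m\<bar> < e" using m e(1) by (simp add: field_simps)
  then have "axis_rotation k (t / real m) \<in> U" using e(2) by (auto simp: subset_iff)
  then obtain A where A: "lifts (axis_rotation k (t / real m)) A"
    using N(3) U(2) axis_rotation_in_SO3 by blast
  have "\<exists>B. lifts (axis_rotation k (real i * (t / real m))) B" for i
  proof (induction i)
    case 0
    then show ?case using lifts_one by auto
  next
    case (Suc i)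
    then obtain B where "lifts (axis_rotation k (real i * (t / real m))) B" by blast
    then have "lifts (axis_rotation k (t / real m) ** axis_rotation k (real i * (t / real m))) (\<lambda>x. A (B x))"
      by (rule lifts_mult [OF A])
    moreover have "real (Suc i) * (t / real m) = t / real m + real i * (t / real m)"
      by (simp add: distrib_right add_divide_distrib)
    ultimately show ?case by (auto simp only: axis_rotation_add)
  qed
  from this [of m] show ?thesis using \<open>m > 0\<close> by simp
qed

theorem (in lens_SO3_action) no_lens_SO3_action: False
proof -
  obtain A B where "lifts (axis_rotation 1 pi) A" "lifts (axis_rotation 3 pi) B"
    using axis_rotation_lifts by blast
  then obtain A' B' where A: "lifts (axis_rotation 1 pi) A'" "free_involution A'"
      and B: "lifts (axis_rotation 3 pi) B'" "free_involution B'"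
    by (meson lifts_free_involution half_turns(1,2))
  show False
    by (rule no_free_klein_four_action_on_sphere [OF A(2) B(2)
          lifts_product_free_involution [OF A B half_turns(3,4)]])
qed

theorem theorem4p3:
  fixes p :: nat and q :: "'n::finite \<Rightarrow> int"
  assumes "prime p" and "odd p" and "\<And>i. coprime (q i) (int p)"
  shows "\<not> (\<exists>\<phi>. continuous_action SO3 SO3_topology (lens_space p q) \<phi> \<and>
                free_action SO3 (topspace (lens_space p q)) \<phi>)"
proof
  assume "\<exists>\<phi>. continuous_action SO3 SO3_topology (lens_space p q) \<phi> \<and>
                free_action SO3 (topspace (lens_space p q)) \<phi>"
  then obtain \<phi> where \<phi>: "continuous_action SO3 SO3_topology (lens_space p q) \<phi>"
      "free_action SO3 (topspace (lens_space p q)) \<phi>" by blast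
  have "p > 0" using assms(1) by (rule prime_gt_0_nat)
  with assms \<phi> have "lens_SO3_action p q \<phi>"
    by (intro lens_SO3_action.intro lens.intro lens_SO3_action_axioms.intro)
  then show False by (rule lens_SO3_action.no_lens_SO3_action)
qed

end
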